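(* Assume (A1)–(A8) and (B1)–(B3) of the context. Let $\{f_\varepsilon\}_{0<\varepsilon<\varepsilon_0}$ be sufficiently regular solutions of the rescaled Boltzmann equation $\partial_t f_\varepsilon+v\cdot\nabla_x f_\varepsilon=\frac1\varepsilon Q(f_\varepsilon,f_\varepsilon)$ on $\Omega_x\times\mathbb{R}^d\times[0,t_*]$, where $[0,t_*]$ is a time interval on which the macroscopic fields $(\rho,u,T)$ remain in $H^s_x$ with the bounds required in (A7). Write $f_\varepsilon=f^{(0)}+\varepsilon f^{(1)}+R_\varepsilon$ with $f^{(0)}=M[\rho,u,T]$ and $f^{(1)}$ the first Chapman–Enskog correction, and assume $\|R_\varepsilon\|_{L^2_xL^2_v(M^{-1})}\le C\varepsilon^2$ for all $0<\varepsilon<\varepsilon_0$. Then production of $O(\varepsilon)$ deviatoric stress necessarily requires $f^{(1)}\not\equiv0$; that is, if $f^{(1)}\equiv0$, then the deviatoric stress of $f_\varepsilon$, $$\tau_{ij}=P_{ij}-\tfrac1dP_{kk}\delta_{ij},\qquad P_{ij}=\int_{\mathbb{R}^d}(v_i-u_i)(v_j-u_j)f_\varepsilon\,dv,$$ has no $O(\varepsilon)$ contribution: it is $\mathcal{O}(\varepsilon^2)$ in $L^2_x$.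
   Context: Notation. $d$ is the spatial dimension, $f(x,v,t)$ a single-particle distribution function, $\langle v\rangle=(1+|v|^2)^{1/2}$, and $R$ (without subscript) the gas constant per unit mass. The local Maxwellian is $M[\rho,u,T](v)=\frac{\rho}{(2\pi RT)^{d/2}}\exp\bigl(-\frac{|v-u|^2}{2RT}\bigr)$, with density $\rho$, velocity $u$, temperature $T$ depending on $(x,t)$. $Q$ is the Boltzmann collision operator; $L_x=DQ[M]$ is its linearization at $M[\rho(x,t),u(x,t),T(x,t)]$, acting on $L^2_v(M^{-1}dv)$ (also written $L$); $\langle\cdot,\cdot\rangle$ is the inner product of $L^2_v(M^{-1}dv)$; $N(L)$ is the nullspace, $N(L)^\perp$ its orthogonal complement in this space, $\mathsf{P}$ the orthogonal projection onto $N(L)$, and $L^{-1}$ the pseudoinverse on $N(L)^\perp$. The operator $\partial_t^{(0)}$ is the leading-order Chapman–Enskog time derivative: $\partial_t^{(0)}f^{(0)}$ is obtained by the chain rule, with time derivatives of $(\rho,u,T)$ replaced by spatial derivatives through the compressible Euler equations. The first Chapman–Enskog correction $f^{(1)}$ is the element of $N(L_x)^\perp$, for each $x$, solving the first-order Chapman–Enskog equation $L_xf^{(1)}=(\partial_t^{(0)}+v\cdot\nabla_x)f^{(0)}$. Any initial-layer corrections violating the orthogonality of $(\partial_t^{(0)}+v\cdot\nabla_x)f^{(0)}$ to the collision invariants are absorbed into the component $\mathsf{P}R_\varepsilon$ of the remainder. Constants depend only on $\|(\rho,u,T)\|_{H^s_x}$, the spectral-gap or hypocoercivity constants, $C_{\mathrm{inv}}$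 and the domain geometry. Assumptions. (A1) $Q$ corresponds to a physically realistic interaction law (hard spheres or cutoff Maxwell-type potentials). It is well defined as a bilinear map $L^1_v(\langle v\rangle^m)\times L^1_v(\langle v\rangle^m)\to L^1_v(\langle v\rangle^m)$, extends under Maxwellian weights to a bounded bilinear form on velocity-weighted $L^2$ spaces, conserves mass, momentum and energy, and satisfies the standard H-theorem. (A2) Either $\Omega_x=\mathbb{T}^d$, or $\Omega_x=\mathbb{R}^d$ with sufficient decay that integrations by parts produce no boundary terms; in the latter case the macroscopic fields and kinetic perturbations lie in $H^s_x(\mathbb{R}^d)$, $s>d/2$, with polynomial velocity weights sufficient to control all moments used. Inhomogeneous walls and externally imposed fluxes are excluded. (A3) The initial datum $f_0$ satisfies $f_0-M\in H^s_xL^2_v(\langle v\rangle^k)$ with $s>d/2$, $k\ge2$, for a global Maxwellian $M$, with weights chosen to control the velocity moments entering the coercivity and inversion estimates. (A4) $\varepsilon$ is the Knudsen number, the Chapman–Enskog expansion $f=f^{(0)}+\varepsilon f^{(1)}+\varepsilon^2f^{(2)}+O(\varepsilon^3)$ is used with $f^{(0)}=M[\rho,u,T]$, and the remainder satisfies $\|R_\varepsilon\|_{L^2_xL^2_v(M^{-1})}\le C\varepsilon^2$ for $0<\varepsilon<\varepsilon_0$ (if this cannot be proven for a kernel, it is an explicit hypothesis). (A5) For each $x$: $N(L)=\mathrm{span}\{M,v_1M,\dots,v_dM,|v|^2M\}$ and $L^2_v(M^{-1})=N(L)\oplus N(L)^\perp$; and either there is a uniform spectral gap $\langle-Lg,g\rangle\ge\lambda_0\|g\|^2_{L^2_v(M^{-1})}$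 for $g\in N(L)^\perp$, with $\lambda_0>0$ independent of $x$, or $L$ satisfies quantitative hypocoercive estimates (in the sense of Villani, Mouhot–Strain, Caflisch: coercivity in a weighted hypocoercive norm with derivative-correction terms). (A6) For each $x$, $Lg=h$ has a solution $g\in N(L)^\perp$ if and only if $\int h(v)\phi(v)\,dv=0$ for all $\phi\in\mathrm{span}\{1,v_1,\dots,v_d,|v|^2\}$. The pseudoinverse $L_x^{-1}:N(L_x)^\perp\to N(L_x)^\perp$ exists and $\|L_x^{-1}\|\le C_{\mathrm{inv}}$ uniformly whenever (A7) holds, with $L_x^{-1}$ continuous under smooth variations of $M(x,v)$. (A7) $(\rho,u,T)\in H^s_x$, $s>d/2$, with uniformly bounded derivatives up to the degree required by the hypocoercive estimates; this guarantees that $(\partial_t^{(0)}+v\cdot\nabla_x)f^{(0)}$ lies in the weighted spaces on which $L^{-1}$ acts and that all operator constants are uniform in $x$. (A8) The kinetic evolution is closed and deterministic: no external forcing, stochastic inputs, imposed shear, or inhomogeneous boundary injections. Operator bounds. (B1) The nullspace structure and the coercivity (or hypocoercivity) in (A5) hold, with $\lambda_0>0$ depending only on the interaction kernel and the macroscopic bounds in (A7). (B2) The solvability criterion and the uniform pseudoinverse bound $C_{\mathrm{inv}}$ in (A6) hold. (B3) If the macroscopic fields of $f^{(0)}$ satisfy the leading-order Euler equations pointwise in $x$, then $\mathsf{P}\bigl((\partial_t^{(0)}+v\cdot\nabla_x)f^{(0)}\bigr)=0$; if they hold only up to $O(\varepsilon)$ errors, the resulting $O(\varepsilon)$ terms are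 incorporated into $\mathsf{P}R_\varepsilon$. *)

theory Defs
  imports "HOL-Analysis.Analysis"
begin

section \<open>Function spaces in velocity and space\<close>

text \<open>Elements of $L^2$ are represented by functions; identities between them are stated
  almost everywhere.\<close>

definition in_L2 :: "'a measure \<Rightarrow> ('a \<Rightarrow> real) \<Rightarrow> bool" where
  "in_L2 \<nu> g \<longleftrightarrow> g \<in> borel_measurable \<nu> \<and> integrable \<nu> (\<lambda>z. (g z)\<^sup>2)"

definition inner_L2 :: "'a measure \<Rightarrow> ('a \<Rightarrow> real) \<Rightarrow> ('a \<Rightarrow> real) \<Rightarrow> real" where
  "inner_L2 \<nu> g h = (\<integral>z. g z * h z \<partial>\<nu>)"

definition norm_L2 :: "'a measure \<Rightarrow> ('a \<Rightarrow> real) \<Rightarrow> real" where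
  "norm_L2 \<nu> g = sqrt (\<integral>z. (g z)\<^sup>2 \<partial>\<nu>)"

definition L2_bounded :: "'a measure \<Rightarrow> real \<Rightarrow> ('a \<Rightarrow> real) \<Rightarrow> bool" where
  "L2_bounded \<nu> b g \<longleftrightarrow> in_L2 \<nu> g \<and> norm_L2 \<nu> g \<le> b"

definition bracket :: "real^'n \<Rightarrow> real" where
  "bracket v = sqrt (1 + (norm v)\<^sup>2)"

text \<open>Weights are attached to the measure: $L^p_v(w)$ is $L^p(w\,dv)$, as in $L^2_v(M^{-1}dv)$.\<close>

definition in_L1w :: "real \<Rightarrow> (real^'n \<Rightarrow> real) \<Rightarrow> bool" where
  "in_L1w m g \<longleftrightarrow> integrable lborel (\<lambda>v. bracket v powr m * g v)"

definition norm_L1w :: "real \<Rightarrow> (real^'n \<Rightarrow> real) \<Rightarrow> real" where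
  "norm_L1w m g = (\<integral>v. bracket v powr m * \<bar>g v\<bar> \<partial>lborel)"

text \<open>The torus is $\mathbb{R}^d/\mathbb{Z}^d$; functions on it are periodic functions on
  $\mathbb{R}^d$, integrated over the unit cube.\<close>

datatype spatial_domain = Torus | WholeSpace

definition periodic :: "spatial_domain \<Rightarrow> (real^'n \<Rightarrow> 'b) \<Rightarrow> bool" where
  "periodic \<Omega> g \<longleftrightarrow> (\<Omega> = Torus \<longrightarrow> (\<forall>x i. g (x + axis i 1) = g x))"

definition space_measure :: "spatial_domain \<Rightarrow> (real^'n) measure" where
  "space_measure \<Omega> = (case \<Omega> of
     Torus \<Rightarrow> density lborel (indicator (cbox 0 (\<chi> i. 1)))
   | WholeSpace \<Rightarrow> lborel)"

text \<open>Plancherel measure of the dual group: counting measure on $2\pi\mathbb{Z}^d$ for the torus,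
  $(2\pi)^{-d}d\xi$ for the whole space. In both cases $g(x)=\int\hat g(\xi)e^{i\xi\cdot x}$
  and $\|g\|_{L^2}=\|\hat g\|_{L^2}$ with respect to this measure.\<close>

definition frequency_measure :: "spatial_domain \<Rightarrow> (real^'n) measure" where
  "frequency_measure \<Omega> = (case \<Omega> of
     Torus \<Rightarrow> distr (count_space (UNIV :: (int^'n) set)) borel
                 (\<lambda>k. \<chi> i. 2 * pi * of_int (k $ i))
   | WholeSpace \<Rightarrow> density lborel (\<lambda>\<xi>. ennreal ((1 / (2 * pi)) ^ CARD('n))))"

text \<open>$\|g\|_{H^s_x}\le b$. The Fourier definition is used through the inversion formula; this is
  legitimate only for $s>d/2$, where $\int(1+|\xi|^2)^s|\hat g|^2<\infty$ makes $\hat g$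
  integrable.\<close>

definition Hs_bounded :: "spatial_domain \<Rightarrow> real \<Rightarrow> real \<Rightarrow> (real^'n \<Rightarrow> real) \<Rightarrow> bool" where
  "Hs_bounded \<Omega> s b g \<longleftrightarrow> g \<in> borel_measurable borel \<and>
     (\<exists>F :: real^'n \<Rightarrow> complex. F \<in> borel_measurable borel \<and>
        (\<integral>\<^sup>+\<xi>. ennreal ((1 + (norm \<xi>)\<^sup>2) powr s * (cmod (F \<xi>))\<^sup>2) \<partial>frequency_measure \<Omega>)
           \<le> ennreal (b\<^sup>2) \<and>
        (AE x in space_measure \<Omega>.
           complex_of_real (g x) = (\<integral>\<xi>. F \<xi> * cis (\<xi> \<bullet> x) \<partial>frequency_measure \<Omega>)))"

definition in_HsL2 ::
    "spatial_domain \<Rightarrow> real \<Rightarrow> real \<Rightarrow> (real^'n \<Rightarrow> real^'n \<Rightarrow> real) \<Rightarrow> bool" where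
  "in_HsL2 \<Omega> s k g \<longleftrightarrow>
     (\<lambda>(x, v). g x v) \<in> borel_measurable (space_measure \<Omega> \<Otimes>\<^sub>M lborel) \<and>
     (\<exists>F :: (real^'n) \<times> (real^'n) \<Rightarrow> complex. F \<in> borel_measurable borel \<and>
        (\<integral>\<^sup>+(\<xi>, v). ennreal ((1 + (norm \<xi>)\<^sup>2) powr s * bracket v powr k * (cmod (F (\<xi>, v)))\<^sup>2)
           \<partial>(frequency_measure \<Omega> \<Otimes>\<^sub>M lborel)) < \<infinity> \<and>
        (AE (x, v) in space_measure \<Omega> \<Otimes>\<^sub>M lborel.
           complex_of_real (g x v) = (\<integral>\<xi>. F (\<xi>, v) * cis (\<xi> \<bullet> x) \<partial>frequency_measure \<Omega>)))"

text \<open>By Cauchy--Schwarz, this makes the velocity moments of order at most two finite on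
  $L^2_v(\langle v\rangle^k)$.\<close>

definition controls_moments :: "real \<Rightarrow> 'n::finite itself \<Rightarrow> bool" where
  "controls_moments k _ \<longleftrightarrow> integrable lborel (\<lambda>v::real^'n. bracket v powr (4 - k))"

abbreviation pd :: "'n::finite \<Rightarrow> (real^'n \<Rightarrow> 'b::real_normed_vector) \<Rightarrow> real^'n \<Rightarrow> 'b" where
  "pd i g x \<equiv> frechet_derivative g (at x) (axis i 1)"

primrec Ck_bounded :: "real \<Rightarrow> nat \<Rightarrow> (real^'n \<Rightarrow> 'b::real_normed_vector) \<Rightarrow> bool" where
  "Ck_bounded D 0 g \<longleftrightarrow> continuous_on UNIV g \<and> (\<forall>x. norm (g x) \<le> D)"
| "Ck_bounded D (Suc n) g \<longleftrightarrow> continuous_on UNIV g \<and> (\<forall>x. norm (g x) \<le> D) \<and>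
     (\<forall>x. g differentiable (at x)) \<and> (\<forall>i. Ck_bounded D n (pd i g))"


section \<open>Maxwellians and the collision operator\<close>

text \<open>A macroscopic state is a triple (density, velocity, temperature).\<close>

type_synonym 'n state = "real \<times> (real^'n) \<times> real"

abbreviation dens :: "'n::finite state \<Rightarrow> real" where "dens w \<equiv> fst w"
abbreviation vel :: "'n::finite state \<Rightarrow> real^'n" where "vel w \<equiv> fst (snd w)"
abbreviation temp :: "'n::finite state \<Rightarrow> real" where "temp w \<equiv> snd (snd w)"

definition maxwellian :: "real \<Rightarrow> 'n::finite state \<Rightarrow> real^'n \<Rightarrow> real" where
  "maxwellian Rgas w v =
     dens w / (2 * pi * Rgas * temp w) powr (real CARD('n) / 2)
       * exp (- (norm (v - vel w))\<^sup>2 / (2 * Rgas * temp w))"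

definition L2v :: "real \<Rightarrow> 'n::finite state \<Rightarrow> (real^'n) measure" where
  "L2v Rgas w = density lborel (\<lambda>v. ennreal (1 / maxwellian Rgas w v))"

text \<open>Surface measure of the unit sphere: $\int_{S^{d-1}}h\,d\sigma=d\int_{|x|<1}h(x/|x|)\,dx$.\<close>

definition sphere_measure :: "(real^'n) measure" where
  "sphere_measure =
     distr (density lborel (\<lambda>x. ennreal (real CARD('n)) * indicator (ball 0 1) x)) borel
       (\<lambda>x. x /\<^sub>R norm x)"

text \<open>Collision kernels in the $\omega$-representation: hard spheres $c\,|z\cdot\omega|$, and
  (Grad cutoff) Maxwell molecules $b(|z\cdot\omega|/|z|)$, where $z=v-v_*$.\<close>

datatype kernel = HardSphere real | CutoffMaxwell "real \<Rightarrow> real"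

definition kernel_fun :: "kernel \<Rightarrow> real^'n \<Rightarrow> real^'n \<Rightarrow> real" where
  "kernel_fun kern z \<omega> = (case kern of
     HardSphere c \<Rightarrow> c * \<bar>z \<bullet> \<omega>\<bar>
   | CutoffMaxwell b \<Rightarrow> b (\<bar>z \<bullet> \<omega>\<bar> / norm z))"

definition admissible_kernel :: "kernel \<Rightarrow> 'n::finite itself \<Rightarrow> bool" where
  "admissible_kernel kern _ \<longleftrightarrow> (case kern of
     HardSphere c \<Rightarrow> c > 0
   | CutoffMaxwell b \<Rightarrow> b \<in> borel_measurable borel \<and> (\<forall>c. 0 \<le> b c) \<and>
       (\<forall>e::real^'n. norm e = 1 \<longrightarrow> integrable sphere_measure (\<lambda>\<omega>. b \<bar>e \<bullet> \<omega>\<bar>)))"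

definition post1 :: "real^'n \<Rightarrow> real^'n \<Rightarrow> real^'n \<Rightarrow> real^'n" where
  "post1 v w \<omega> = v - ((v - w) \<bullet> \<omega>) *\<^sub>R \<omega>"

definition post2 :: "real^'n \<Rightarrow> real^'n \<Rightarrow> real^'n \<Rightarrow> real^'n" where
  "post2 v w \<omega> = w + ((v - w) \<bullet> \<omega>) *\<^sub>R \<omega>"

definition Q_integrand ::
    "kernel \<Rightarrow> (real^'n \<Rightarrow> real) \<Rightarrow> (real^'n \<Rightarrow> real) \<Rightarrow> real^'n \<Rightarrow> (real^'n) \<times> (real^'n) \<Rightarrow> real" where
  "Q_integrand kern f g v = (\<lambda>(w, \<omega>). kernel_fun kern (v - w) \<omega> *
     (f (post1 v w \<omega>) * g (post2 v w \<omega>) - f v * g w))"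

definition Q_defined ::
    "kernel \<Rightarrow> (real^'n \<Rightarrow> real) \<Rightarrow> (real^'n \<Rightarrow> real) \<Rightarrow> real^'n \<Rightarrow> bool" where
  "Q_defined kern f g v \<longleftrightarrow> integrable (lborel \<Otimes>\<^sub>M sphere_measure) (Q_integrand kern f g v)"

definition Q ::
    "kernel \<Rightarrow> (real^'n \<Rightarrow> real) \<Rightarrow> (real^'n \<Rightarrow> real) \<Rightarrow> real^'n \<Rightarrow> real" where
  "Q kern f g v = (\<integral>z. Q_integrand kern f g v z \<partial>(lborel \<Otimes>\<^sub>M sphere_measure))"

text \<open>The span of $1,v_1,\dots,v_d,|v|^2$.\<close>

definition collision_invariants :: "(real^'n \<Rightarrow> real) set" where
  "collision_invariants = {\<lambda>v. a + b \<bullet> v + c * (norm v)\<^sup>2 | a b c. True}"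

definition positive_state :: "'n::finite state \<Rightarrow> bool" where
  "positive_state w \<longleftrightarrow> 0 < dens w \<and> 0 < temp w"

text \<open>The H-theorem is stated for positive densities for which the absolute entropy production
  integral converges, so that the symmetrisation of $\int Q(f,f)\ln f$ is meaningful.\<close>

definition entropy_admissible :: "kernel \<Rightarrow> (real^'n \<Rightarrow> real) \<Rightarrow> bool" where
  "entropy_admissible kern f \<longleftrightarrow> (\<forall>v. 0 < f v) \<and>
     integrable (lborel \<Otimes>\<^sub>M (lborel \<Otimes>\<^sub>M sphere_measure))
       (\<lambda>(v, w, \<omega>). kernel_fun kern (v - w) \<omega> *
          (f (post1 v w \<omega>) * f (post2 v w \<omega>) + f v * f w) * ln (f v))"

text \<open>The input weight \<open>m\<close> and output weight \<open>m'\<close> of the $L^1$ bound may differ: for hard spheres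
  one power of $\langle v\rangle$ is lost. Likewise for the weights of the $L^2$ bound.\<close>

definition collision_law :: "real \<Rightarrow> kernel \<Rightarrow> 'n::finite itself \<Rightarrow> bool" where
  "collision_law Rgas kern TYPE_n \<longleftrightarrow>
     admissible_kernel kern TYPE_n \<and>
     (\<exists>m m' c. 2 \<le> m' \<and> m' \<le> m \<and>
        (\<forall>f g :: real^'n \<Rightarrow> real. in_L1w m f \<longrightarrow> in_L1w m g \<longrightarrow>
            (AE v in lborel. Q_defined kern f g v) \<and> in_L1w m' (Q kern f g) \<and>
            norm_L1w m' (Q kern f g) \<le> c * norm_L1w m f * norm_L1w m g) \<and>
        (\<forall>f :: real^'n \<Rightarrow> real. in_L1w m f \<longrightarrow>
            (\<forall>\<phi>\<in>collision_invariants. (\<integral>v. Q kern f f v * \<phi> v \<partial>lborel) = 0)) \<and>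
        (\<forall>f :: real^'n \<Rightarrow> real. in_L1w m f \<longrightarrow> entropy_admissible kern f \<longrightarrow>
            (\<integral>v. Q kern f f v * ln (f v) \<partial>lborel) \<le> 0 \<and>
            ((\<integral>v. Q kern f f v * ln (f v) \<partial>lborel) = 0 \<longleftrightarrow>
               (\<exists>w. positive_state w \<and> (AE v in lborel. f v = maxwellian Rgas w v))))) \<and>
     (\<exists>k k'. \<forall>w :: 'n state. positive_state w \<longrightarrow>
        (\<exists>c. \<forall>f g.
           let \<nu> = (\<lambda>q. density lborel (\<lambda>v. ennreal (bracket v powr q / maxwellian Rgas w v)))
           in in_L2 (\<nu> k) f \<longrightarrow> in_L2 (\<nu> k) g \<longrightarrow>
              (AE v in lborel. Q_defined kern f g v) \<and>
              L2_bounded (\<nu> k') (c * norm_L2 (\<nu> k) f * norm_L2 (\<nu> k) g) (Q kern f g)))"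


section \<open>The linearised operator\<close>

text \<open>$L=DQ[M]$, the derivative of $f\mapsto Q(f,f)$ at $M$.\<close>

definition lin :: "kernel \<Rightarrow> real \<Rightarrow> 'n::finite state \<Rightarrow> (real^'n \<Rightarrow> real) \<Rightarrow> real^'n \<Rightarrow> real" where
  "lin kern Rgas w g v = Q kern (maxwellian Rgas w) g v + Q kern g (maxwellian Rgas w) v"

text \<open>For hard spheres $L$ is unbounded on $L^2_v(M^{-1})$; this is its maximal domain.\<close>

definition lin_dom :: "kernel \<Rightarrow> real \<Rightarrow> 'n::finite state \<Rightarrow> (real^'n \<Rightarrow> real) set" where
  "lin_dom kern Rgas w = {g. in_L2 (L2v Rgas w) g \<and>
     (AE v in lborel. Q_defined kern (maxwellian Rgas w) g v \<and>
                      Q_defined kern g (maxwellian Rgas w) v) \<and>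
     in_L2 (L2v Rgas w) (lin kern Rgas w g)}"

definition nullspace :: "kernel \<Rightarrow> real \<Rightarrow> 'n::finite state \<Rightarrow> (real^'n \<Rightarrow> real) set" where
  "nullspace kern Rgas w =
     {g \<in> lin_dom kern Rgas w. AE v in lborel. lin kern Rgas w g v = 0}"

definition null_perp :: "kernel \<Rightarrow> real \<Rightarrow> 'n::finite state \<Rightarrow> (real^'n \<Rightarrow> real) set" where
  "null_perp kern Rgas w = {g. in_L2 (L2v Rgas w) g \<and>
     (\<forall>n\<in>nullspace kern Rgas w. inner_L2 (L2v Rgas w) g n = 0)}"

definition is_projection ::
    "kernel \<Rightarrow> real \<Rightarrow> 'n::finite state \<Rightarrow> (real^'n \<Rightarrow> real) \<Rightarrow> (real^'n \<Rightarrow> real) \<Rightarrow> bool" where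
  "is_projection kern Rgas w g p \<longleftrightarrow> in_L2 (L2v Rgas w) g \<and>
     p \<in> nullspace kern Rgas w \<and> (\<lambda>v. g v - p v) \<in> null_perp kern Rgas w"

definition solves_lin ::
    "kernel \<Rightarrow> real \<Rightarrow> 'n::finite state \<Rightarrow> (real^'n \<Rightarrow> real) \<Rightarrow> (real^'n \<Rightarrow> real) \<Rightarrow> bool" where
  "solves_lin kern Rgas w h g \<longleftrightarrow> g \<in> lin_dom kern Rgas w \<and> g \<in> null_perp kern Rgas w \<and>
     (AE v in lborel. lin kern Rgas w g v = h v)"

definition is_pinv ::
    "kernel \<Rightarrow> real \<Rightarrow> 'n::finite state \<Rightarrow> (real^'n \<Rightarrow> real) \<Rightarrow> (real^'n \<Rightarrow> real) \<Rightarrow> bool" where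
  "is_pinv kern Rgas w h g \<longleftrightarrow> h \<in> null_perp kern Rgas w \<and> solves_lin kern Rgas w h g"

definition nullspace_structure :: "kernel \<Rightarrow> real \<Rightarrow> 'n::finite state \<Rightarrow> bool" where
  "nullspace_structure kern Rgas w \<longleftrightarrow>
     (\<forall>g. g \<in> nullspace kern Rgas w \<longleftrightarrow> in_L2 (L2v Rgas w) g \<and>
        (\<exists>\<phi>\<in>collision_invariants. AE v in lborel. g v = \<phi> v * maxwellian Rgas w v)) \<and>
     (\<forall>g. in_L2 (L2v Rgas w) g \<longrightarrow>
        (\<exists>p\<in>nullspace kern Rgas w. \<exists>q\<in>null_perp kern Rgas w. \<forall>v. g v = p v + q v))"

definition spectral_gap :: "kernel \<Rightarrow> real \<Rightarrow> real \<Rightarrow> 'n::finite state \<Rightarrow> bool" where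
  "spectral_gap kern Rgas lambda0 w \<longleftrightarrow>
     (\<forall>g \<in> null_perp kern Rgas w \<inter> lin_dom kern Rgas w.
        inner_L2 (L2v Rgas w) (\<lambda>v. - lin kern Rgas w g v) g
          \<ge> lambda0 * (norm_L2 (L2v Rgas w) g)\<^sup>2)"


subsection \<open>Hypocoercivity\<close>

text \<open>For a frozen state $w$, $\Lambda h=L_wh-v\cdot\nabla_xh$ acts on functions of $(x,v)$. The
  hypocoercive norm is
  $\|h\|^2+a\|\nabla_vh\|^2+2b\langle\nabla_xh,\nabla_vh\rangle+c\|\nabla_xh\|^2$
  with $b^2<ac$, in $L^2(\langle v\rangle^qM_w^{-1}dx\,dv)$.\<close>

definition grad_x :: "(real^'n \<Rightarrow> real^'n \<Rightarrow> real) \<Rightarrow> real^'n \<Rightarrow> real^'n \<Rightarrow> real^'n" where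
  "grad_x h x v = (\<chi> i. pd i (\<lambda>y. h y v) x)"

definition grad_v :: "(real^'n \<Rightarrow> real^'n \<Rightarrow> real) \<Rightarrow> real^'n \<Rightarrow> real^'n \<Rightarrow> real^'n" where
  "grad_v h x v = (\<chi> i. pd i (h x) v)"

definition L2xv :: "spatial_domain \<Rightarrow> real \<Rightarrow> real \<Rightarrow> 'n::finite state \<Rightarrow> ((real^'n) \<times> (real^'n)) measure" where
  "L2xv \<Omega> q Rgas w = density (space_measure \<Omega> \<Otimes>\<^sub>M lborel)
     (\<lambda>(x, v). ennreal (bracket v powr q / maxwellian Rgas w v))"

definition C1_H1 ::
    "spatial_domain \<Rightarrow> ((real^'n) \<times> (real^'n)) measure \<Rightarrow> (real^'n \<Rightarrow> real^'n \<Rightarrow> real) \<Rightarrow> bool" where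
  "C1_H1 \<Omega> \<nu> h \<longleftrightarrow> periodic \<Omega> h \<and>
     (\<forall>z. (\<lambda>(x, v). h x v) differentiable (at z)) \<and>
     continuous_on UNIV (\<lambda>(x, v). grad_x h x v) \<and> continuous_on UNIV (\<lambda>(x, v). grad_v h x v) \<and>
     in_L2 \<nu> (\<lambda>(x, v). h x v) \<and>
     in_L2 \<nu> (\<lambda>(x, v). norm (grad_x h x v)) \<and> in_L2 \<nu> (\<lambda>(x, v). norm (grad_v h x v))"

definition kinetic_op ::
    "kernel \<Rightarrow> real \<Rightarrow> 'n::finite state \<Rightarrow> (real^'n \<Rightarrow> real^'n \<Rightarrow> real) \<Rightarrow> real^'n \<Rightarrow> real^'n \<Rightarrow> real" where
  "kinetic_op kern Rgas w h x v =
     lin kern Rgas w (h x) v - frechet_derivative (\<lambda>y. h y v) (at x) v"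

definition kinetic_dom ::
    "spatial_domain \<Rightarrow> real \<Rightarrow> kernel \<Rightarrow> real \<Rightarrow> 'n::finite state \<Rightarrow> (real^'n \<Rightarrow> real^'n \<Rightarrow> real) set" where
  "kinetic_dom \<Omega> q kern Rgas w = {h. C1_H1 \<Omega> (L2xv \<Omega> q Rgas w) h \<and>
     (\<forall>x. h x \<in> lin_dom kern Rgas w) \<and>
     C1_H1 \<Omega> (L2xv \<Omega> q Rgas w) (kinetic_op kern Rgas w h)}"

definition hypo_inner ::
    "((real^'n) \<times> (real^'n)) measure \<Rightarrow> real \<Rightarrow> real \<Rightarrow> real \<Rightarrow>
     (real^'n \<Rightarrow> real^'n \<Rightarrow> real) \<Rightarrow> (real^'n \<Rightarrow> real^'n \<Rightarrow> real) \<Rightarrow> real" where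
  "hypo_inner \<nu> a b c g h = (\<integral>(x, v). g x v * h x v + a * (grad_v g x v \<bullet> grad_v h x v)
     + b * (grad_x g x v \<bullet> grad_v h x v + grad_v g x v \<bullet> grad_x h x v)
     + c * (grad_x g x v \<bullet> grad_x h x v) \<partial>\<nu>)"

definition hypocoercive ::
    "spatial_domain \<Rightarrow> real \<Rightarrow> real \<Rightarrow> real \<Rightarrow> real \<Rightarrow> kernel \<Rightarrow> real \<Rightarrow> real \<Rightarrow> 'n::finite state \<Rightarrow> bool" where
  "hypocoercive \<Omega> q a b c kern Rgas lambda0 w \<longleftrightarrow>
     (\<forall>h \<in> kinetic_dom \<Omega> q kern Rgas w.
        (\<forall>n \<in> kinetic_dom \<Omega> q kern Rgas w. (\<forall>x v. kinetic_op kern Rgas w n x v = 0) \<longrightarrow>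
           inner_L2 (L2xv \<Omega> 0 Rgas w) (\<lambda>(x, v). h x v) (\<lambda>(x, v). n x v) = 0) \<longrightarrow>
        hypo_inner (L2xv \<Omega> q Rgas w) a b c (\<lambda>x v. - kinetic_op kern Rgas w h x v) h
          \<ge> lambda0 * hypo_inner (L2xv \<Omega> q Rgas w) a b c h h)"


section \<open>Assumptions on the macroscopic fields and on the linearised operator\<close>

text \<open>Fields are functions \<open>W\<close> of time and position with values in the states.\<close>

definition coercivity_assumption ::
    "spatial_domain \<Rightarrow> kernel \<Rightarrow> real \<Rightarrow> real \<Rightarrow> real \<Rightarrow> (real \<Rightarrow> real^'n \<Rightarrow> 'n::finite state) \<Rightarrow> bool" where
  "coercivity_assumption \<Omega> kern Rgas lambda0 tstar W \<longleftrightarrow>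
     (\<forall>t\<in>{0..tstar}. \<forall>x. nullspace_structure kern Rgas (W t x)) \<and>
     ((\<forall>t\<in>{0..tstar}. \<forall>x. spectral_gap kern Rgas lambda0 (W t x)) \<or>
      (\<exists>q a b c. 0 \<le> q \<and> 0 < a \<and> 0 < c \<and> b\<^sup>2 < a * c \<and>
         (\<forall>t\<in>{0..tstar}. \<forall>x. hypocoercive \<Omega> q a b c kern Rgas lambda0 (W t x))))"

text \<open>Since the spaces $L^2_v(M^{-1})$ vary with $x$, continuity of $L_x^{-1}$ in $x$ is expressed
  after the unitary conjugation $h\mapsto M^{-1/2}h$ onto the fixed space $L^2_v$.\<close>

definition inversion_assumption ::
    "kernel \<Rightarrow> real \<Rightarrow> real \<Rightarrow> real \<Rightarrow> (real \<Rightarrow> real^'n \<Rightarrow> 'n::finite state) \<Rightarrow> bool" where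
  "inversion_assumption kern Rgas C_inv tstar W \<longleftrightarrow>
     (\<forall>t\<in>{0..tstar}. \<forall>x.
        (\<forall>h. in_L2 (L2v Rgas (W t x)) h \<longrightarrow>
           ((\<exists>g. solves_lin kern Rgas (W t x) h g) \<longleftrightarrow>
            (\<forall>\<phi>\<in>collision_invariants. (\<integral>v. h v * \<phi> v \<partial>lborel) = 0))) \<and>
        (\<forall>h\<in>null_perp kern Rgas (W t x). \<exists>g. is_pinv kern Rgas (W t x) h g) \<and>
        (\<forall>h g. is_pinv kern Rgas (W t x) h g \<longrightarrow>
           norm_L2 (L2v Rgas (W t x)) g \<le> C_inv * norm_L2 (L2v Rgas (W t x)) h)) \<and>
     (\<forall>t\<in>{0..tstar}. \<forall>X x H h G g. X \<longlonglongrightarrow> x \<longrightarrow>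
        (\<forall>n. is_pinv kern Rgas (W t (X n)) (H n) (G n)) \<longrightarrow> is_pinv kern Rgas (W t x) h g \<longrightarrow>
        (\<lambda>n. norm_L2 lborel (\<lambda>v. H n v / sqrt (maxwellian Rgas (W t (X n)) v)
                               - h v / sqrt (maxwellian Rgas (W t x) v))) \<longlonglongrightarrow> 0 \<longrightarrow>
        (\<lambda>n. norm_L2 lborel (\<lambda>v. G n v / sqrt (maxwellian Rgas (W t (X n)) v)
                               - g v / sqrt (maxwellian Rgas (W t x) v))) \<longlonglongrightarrow> 0)"

text \<open>$H^s$ membership is relative to a constant state \<open>far\<close>: a positive density or temperature
  that is bounded below is not in $H^s(\mathbb{R}^d)$. For \<open>far = 0\<close> this is literal
  membership of $(\rho,u,T)$ in $H^s$. The norm bound is imposed on every component.\<close>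

definition macroscopic_fields ::
    "spatial_domain \<Rightarrow> real \<Rightarrow> 'n::finite state \<Rightarrow> real \<Rightarrow> nat \<Rightarrow> real \<Rightarrow> real \<Rightarrow>
     (real \<Rightarrow> real^'n \<Rightarrow> 'n state) \<Rightarrow> bool" where
  "macroscopic_fields \<Omega> s far B N D tstar W \<longleftrightarrow>
     (\<forall>t\<in>{0..tstar}. periodic \<Omega> (W t) \<and> (\<forall>x. positive_state (W t x)) \<and>
        (\<forall>e\<in>Basis. Hs_bounded \<Omega> s B (\<lambda>x. (W t x - far) \<bullet> e)) \<and>
        Ck_bounded D N (W t))"


section \<open>Boltzmann equation and Chapman--Enskog expansion\<close>

definition boltzmann_solution ::
    "spatial_domain \<Rightarrow> kernel \<Rightarrow> real \<Rightarrow> real \<Rightarrow> (real \<Rightarrow> real^'n \<Rightarrow> real^'n \<Rightarrow> real) \<Rightarrow> bool" where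
  "boltzmann_solution \<Omega> kern \<epsilon> tstar f \<longleftrightarrow>
     continuous_on ({0..tstar} \<times> UNIV \<times> UNIV) (\<lambda>(t, x, v). f t x v) \<and>
     (\<forall>t\<in>{0..tstar}. periodic \<Omega> (f t) \<and>
        (\<forall>x v. Q_defined kern (f t x) (f t x) v \<and> (\<lambda>y. f t y v) differentiable (at x) \<and>
           (\<exists>ft. ((\<lambda>r. f r x v) has_real_derivative ft) (at t within {0..tstar}) \<and>
              ft + frechet_derivative (\<lambda>y. f t y v) (at x) v = 1 / \<epsilon> * Q kern (f t x) (f t x) v)))"

text \<open>Time derivatives of (density, velocity, temperature) as given by the compressible Euler
  equations of a gas with pressure $\rho RT$ and internal energy $\frac d2RT$ per unit mass.\<close>

definition euler_rate :: "real \<Rightarrow> (real^'n \<Rightarrow> 'n::finite state) \<Rightarrow> real^'n \<Rightarrow> 'n state" where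
  "euler_rate Rgas w x =
     (let div_u = (\<Sum>j\<in>UNIV. pd j (\<lambda>y. vel (w y) $ j) x) in
      (- (\<Sum>j\<in>UNIV. pd j (\<lambda>y. dens (w y) * vel (w y) $ j) x),
       \<chi> i. - (\<Sum>j\<in>UNIV. vel (w x) $ j * pd j (\<lambda>y. vel (w y) $ i) x)
            - 1 / dens (w x) * pd i (\<lambda>y. dens (w y) * Rgas * temp (w y)) x,
       - (\<Sum>j\<in>UNIV. vel (w x) $ j * pd j (\<lambda>y. temp (w y)) x)
         - 2 / real CARD('n) * temp (w x) * div_u))"

definition dt0_maxwellian :: "real \<Rightarrow> (real^'n \<Rightarrow> 'n::finite state) \<Rightarrow> real^'n \<Rightarrow> real^'n \<Rightarrow> real" where
  "dt0_maxwellian Rgas w x v =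
     frechet_derivative (\<lambda>\<theta>. maxwellian Rgas \<theta> v) (at (w x)) (euler_rate Rgas w x)"

text \<open>$(\partial_t^{(0)}+v\cdot\nabla_x)f^{(0)}$.\<close>

definition ce_source :: "real \<Rightarrow> (real^'n \<Rightarrow> 'n::finite state) \<Rightarrow> real^'n \<Rightarrow> real^'n \<Rightarrow> real" where
  "ce_source Rgas w x v = dt0_maxwellian Rgas w x v +
     frechet_derivative (\<lambda>y. maxwellian Rgas (w y) v) (at x) v"

definition first_correction ::
    "kernel \<Rightarrow> real \<Rightarrow> real \<Rightarrow> (real \<Rightarrow> real^'n \<Rightarrow> 'n::finite state) \<Rightarrow>
     (real \<Rightarrow> real^'n \<Rightarrow> real^'n \<Rightarrow> real) \<Rightarrow> bool" where
  "first_correction kern Rgas tstar W f1 \<longleftrightarrow>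
     (\<forall>t\<in>{0..tstar}. \<forall>x. solves_lin kern Rgas (W t x) (ce_source Rgas (W t) x) (f1 t x))"

text \<open>When the Euler equations hold only approximately nothing is imposed here: all defects are
  part of \<open>ce_remainder\<close> below.\<close>

definition euler_projection ::
    "kernel \<Rightarrow> real \<Rightarrow> real \<Rightarrow> (real \<Rightarrow> real^'n \<Rightarrow> 'n::finite state) \<Rightarrow> bool" where
  "euler_projection kern Rgas tstar W \<longleftrightarrow>
     (\<forall>t\<in>{0..tstar}.
        (\<forall>x. ((\<lambda>r. W r x) has_vector_derivative euler_rate Rgas (W t) x) (at t within {0..tstar})) \<longrightarrow>
        (\<forall>x. is_projection kern Rgas (W t x) (ce_source Rgas (W t) x) (\<lambda>v. 0)))"

definition ce_remainder ::
    "real \<Rightarrow> (real \<Rightarrow> real^'n \<Rightarrow> 'n::finite state) \<Rightarrow> (real \<Rightarrow> real^'n \<Rightarrow> real^'n \<Rightarrow> real) \<Rightarrow>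
     (real \<Rightarrow> real \<Rightarrow> real^'n \<Rightarrow> real^'n \<Rightarrow> real) \<Rightarrow> real \<Rightarrow> real \<Rightarrow> real^'n \<Rightarrow> real^'n \<Rightarrow> real" where
  "ce_remainder Rgas W f1 f \<epsilon> t x v = f \<epsilon> t x v - maxwellian Rgas (W t x) v - \<epsilon> * f1 t x v"

text \<open>$L^2_xL^2_v(M^{-1})$ for the local Maxwellian of the fields \<open>w\<close> at a fixed time.\<close>

definition L2x_L2v ::
    "spatial_domain \<Rightarrow> real \<Rightarrow> (real^'n \<Rightarrow> 'n::finite state) \<Rightarrow> ((real^'n) \<times> (real^'n)) measure" where
  "L2x_L2v \<Omega> Rgas w = density (space_measure \<Omega> \<Otimes>\<^sub>M lborel)
     (\<lambda>(x, v). ennreal (1 / maxwellian Rgas (w x) v))"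

definition ce_expansion ::
    "spatial_domain \<Rightarrow> real \<Rightarrow> real \<Rightarrow> real \<Rightarrow> real \<Rightarrow> (real \<Rightarrow> real^'n \<Rightarrow> 'n::finite state) \<Rightarrow>
     (real \<Rightarrow> real^'n \<Rightarrow> real^'n \<Rightarrow> real) \<Rightarrow>
     (real \<Rightarrow> real \<Rightarrow> real^'n \<Rightarrow> real^'n \<Rightarrow> real) \<Rightarrow> bool" where
  "ce_expansion \<Omega> Rgas C \<epsilon>0 tstar W f1 f \<longleftrightarrow>
     (\<forall>\<epsilon>\<in>{0<..<\<epsilon>0}. \<forall>t\<in>{0..tstar}.
        L2_bounded (L2x_L2v \<Omega> Rgas (W t)) (C * \<epsilon>\<^sup>2)
          (\<lambda>(x, v). ce_remainder Rgas W f1 f \<epsilon> t x v)) \<and>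
     (\<exists>f2 C3. \<forall>\<epsilon>\<in>{0<..<\<epsilon>0}. \<forall>t\<in>{0..tstar}.
        L2_bounded (L2x_L2v \<Omega> Rgas (W t)) (C3 * \<epsilon> ^ 3)
          (\<lambda>(x, v). ce_remainder Rgas W f1 f \<epsilon> t x v - \<epsilon>\<^sup>2 * f2 t x v))"

definition initial_datum ::
    "spatial_domain \<Rightarrow> real \<Rightarrow> real \<Rightarrow> real \<Rightarrow> 'n::finite state \<Rightarrow>
     (real^'n \<Rightarrow> real^'n \<Rightarrow> real) \<Rightarrow> bool" where
  "initial_datum \<Omega> Rgas s k glob f0 \<longleftrightarrow>
     2 \<le> k \<and> controls_moments k TYPE('n) \<and> positive_state glob \<and>
     in_HsL2 \<Omega> s k (\<lambda>x v. f0 x v - maxwellian Rgas glob v)"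

definition no_boundary_term :: "(real^'n \<Rightarrow> real) \<Rightarrow> bool" where
  "no_boundary_term g \<longleftrightarrow> (\<forall>i. integrable lborel (pd i g) \<and> (\<integral>x. pd i g x \<partial>lborel) = 0)"

text \<open>On the whole space: the perturbation of the global Maxwellian is $H^s_x$ with polynomial
  velocity weight, and integrating by parts products of fluctuations leaves no boundary term.\<close>

definition whole_space_decay ::
    "spatial_domain \<Rightarrow> real \<Rightarrow> real \<Rightarrow> real \<Rightarrow> 'n::finite state \<Rightarrow> 'n state \<Rightarrow> real \<Rightarrow> real \<Rightarrow>
     (real \<Rightarrow> real^'n \<Rightarrow> 'n state) \<Rightarrow> (real \<Rightarrow> real \<Rightarrow> real^'n \<Rightarrow> real^'n \<Rightarrow> real) \<Rightarrow> bool" where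
  "whole_space_decay \<Omega> Rgas s k glob far \<epsilon>0 tstar W f \<longleftrightarrow>
     (\<Omega> = WholeSpace \<longrightarrow> (\<forall>t\<in>{0..tstar}.
        (\<forall>e\<in>Basis. \<forall>e'\<in>Basis. no_boundary_term (\<lambda>x. ((W t x - far) \<bullet> e) * ((W t x - far) \<bullet> e'))) \<and>
        (\<forall>\<epsilon>\<in>{0<..<\<epsilon>0}.
           in_HsL2 \<Omega> s k (\<lambda>x v. f \<epsilon> t x v - maxwellian Rgas glob v) \<and>
           (AE v in lborel. no_boundary_term (\<lambda>x. (f \<epsilon> t x v - maxwellian Rgas glob v)\<^sup>2)))))"


section \<open>Deviatoric stress\<close>

definition pressure_tensor ::
    "(real^'n) \<Rightarrow> (real^'n \<Rightarrow> real) \<Rightarrow> 'n \<Rightarrow> 'n \<Rightarrow> real" where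
  "pressure_tensor u g i j = (\<integral>v. (v $ i - u $ i) * (v $ j - u $ j) * g v \<partial>lborel)"

definition deviatoric_stress ::
    "(real^'n) \<Rightarrow> (real^'n \<Rightarrow> real) \<Rightarrow> 'n::finite \<Rightarrow> 'n \<Rightarrow> real" where
  "deviatoric_stress u g i j = pressure_tensor u g i j
     - (1 / real CARD('n)) * (\<Sum>k\<in>UNIV. pressure_tensor u g k k) * (if i = j then 1 else 0)"

end

theory Submission
  imports Defs "HOL-Probability.Distributions"
begin

text \<open>If the first correction vanishes, then $f_\varepsilon=M+R_\varepsilon$ with
  $\|R_\varepsilon\|=O(\varepsilon^2)$. The stress is linear in $f_\varepsilon$, and the pressure tensor
  of a Maxwellian is isotropic, $P_{ij}[M]=\rho RT\,\delta_{ij}$, so its deviator vanishes and only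
  $\tau[R_\varepsilon]$ remains. Cauchy--Schwarz in $v$ gives
  \[\Bigl|\int q\,R_\varepsilon\,dv\Bigr|^2\le\int q^2M\,dv\int R_\varepsilon^2M^{-1}dv,
    \qquad q=(v_i-u_i)(v_j-u_j),\]
  and $\int q^2M\,dv\le 3\rho(RT)^2$. Integration in $x$ bounds $\tau$ in $L^2_x$ by a constant times
  $\|R_\varepsilon\|$ (\<open>L2_deviatoric_stress_le\<close>), once $\rho$ and $T$ are bounded above.

  The resulting constant may depend on the fields through their $H^s$ bound only. The upper bounds on
  $\rho$ and $T$ therefore come from the Sobolev embedding $H^s\subset L^\infty$, $s>d/2$: the Fourier
  transform is integrable by Cauchy--Schwarz, because $\int(1+|\xi|^2)^{-s}$ is finite over
  the frequencies (\<open>nn_integral_bessel_weight\<close>, \<open>AE_Hs_bounded_le\<close>).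

  Both that integral and the moments of $M$ reduce to one dimension, since the integrands are, or are
  dominated by, products of functions of the single coordinates.\<close>

section \<open>Integrals of products over the coordinates\<close>

lemma Basis_eq_range_axis: "Basis = range (\<lambda>i::'n::finite. axis i (1::real))"
  by (auto simp: Basis_vec_def)

lemma inj_axis: "inj (\<lambda>i::'n::finite. axis i (1::real))"
  by (auto simp: inj_on_def axis_eq_axis)

text \<open>Fubini's theorem for functions with separated variables.\<close>

lemma has_bochner_integral_vec_prod:
  fixes h :: "'n::finite \<Rightarrow> real \<Rightarrow> real"
  assumes h: "\<And>i. has_bochner_integral lborel (h i) (c i)"
  shows "has_bochner_integral lborel (\<lambda>v::real^'n. \<Prod>i\<in>UNIV. h i (v $ i)) (\<Prod>i\<in>UNIV. c i)"
proof -
  let ?I = "interval_measure (\<lambda>x. x)"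
  interpret product_sigma_finite "\<lambda>_::real^'n. ?I" 
    by (simp add: product_sigma_finite_def lborel_eq_real[symmetric] lborel.sigma_finite_measure_axioms)
  \<comment> \<open>The product measure behind \<open>lborel\<close> is indexed by basis vectors, the factors by coordinates.\<close>
  define g where "g b = h (the_inv (\<lambda>i::'n. axis i (1::real)) b)" for b
  have g: "g (axis i 1) = h i" for i
    unfolding g_def by (subst the_inv_f_f[OF inj_axis]) simp
  have hi: "integrable ?I (h i)" "integral\<^sup>L ?I (h i) = c i" for i
    using h[of i] by (auto simp: lborel_eq_real[symmetric] has_bochner_integral_iff)
  have gi: "integrable ?I (g b)" for b unfolding g_def by (rule hi)
  have hm[measurable]: "h i \<in> borel_measurable borel" for i
    using h[of i] by (auto dest: borel_measurable_has_bochner_integral)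
  have P: "(\<Prod>b\<in>Basis. g b (f b)) = (\<Prod>i\<in>UNIV. h i ((\<Sum>b\<in>Basis. f b *\<^sub>R b) $ i))" for f :: "real^'n \<Rightarrow> real"
  proof -
    have "(\<Sum>b\<in>Basis. f b *\<^sub>R b) $ i = f (axis i 1)" for i
    proof -
      have "(\<Sum>b\<in>Basis. f b *\<^sub>R b) $ i = (\<Sum>b\<in>Basis. f b *\<^sub>R b) \<bullet> axis i 1"
        by (simp add: inner_axis)
      also have "\<dots> = f (axis i 1)"
        by (rule inner_sum_left_Basis) auto
      finally show ?thesis .
    qed
    then show ?thesis
      unfolding Basis_eq_range_axis by (simp add: prod.reindex[OF inj_axis] g)
  qed
  have sum_m[measurable]: "(\<lambda>f. \<Sum>b\<in>Basis. f b *\<^sub>R b) \<in> (\<Pi>\<^sub>M b\<in>(Basis::(real^'n) set). ?I) \<rightarrow>\<^sub>M borel"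
    by measurable
  have "integrable (\<Pi>\<^sub>M b\<in>(Basis::(real^'n) set). ?I) (\<lambda>f. \<Prod>b\<in>Basis. g b (f b))"
    by (intro product_integrable_prod gi) auto
  moreover have "(\<integral>f. (\<Prod>b\<in>Basis. g b (f b)) \<partial>(\<Pi>\<^sub>M b\<in>(Basis::(real^'n) set). ?I)) = (\<Prod>b\<in>Basis. integral\<^sup>L ?I (g b))"
    by (intro product_integral_prod gi) auto
  moreover have "(\<Prod>b\<in>(Basis::(real^'n) set). integral\<^sup>L ?I (g b)) = (\<Prod>i\<in>UNIV. c i)"
    unfolding Basis_eq_range_axis by (simp add: prod.reindex[OF inj_axis] g hi(2))
  ultimately show ?thesis
    unfolding has_bochner_integral_iff lborel_def
    by (simp add: integrable_distr_eq integral_distr P)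
qed

section \<open>Sobolev embedding\<close>

text \<open>Each factor $1+\xi_i^2$ is at most $1+|\xi|^2$. Distributing the exponent evenly over the $d$
  coordinates turns $s>d/2$ into the sharp one-dimensional condition $s/d>1/2$.\<close>

lemma bessel_weight_le_prod:
  fixes \<xi> :: "real^'n" and s :: real
  assumes "0 \<le> s"
  shows "(1 + (norm \<xi>)\<^sup>2) powr (- s) \<le> (\<Prod>i\<in>UNIV. (1 + (\<xi> $ i)\<^sup>2) powr (- (s / real CARD('n))))"
proof -
  have "(1 + (norm \<xi>)\<^sup>2) powr (- s) = ((1 + (norm \<xi>)\<^sup>2) powr (- (s / real CARD('n)))) powr real CARD('n)"
    by (simp add: powr_powr)
  also have "\<dots> = (\<Prod>i\<in>(UNIV::'n set). (1 + (norm \<xi>)\<^sup>2) powr (- (s / real CARD('n))))"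
    by (subst powr_realpow) (simp_all add: add_pos_nonneg less_imp_neq[symmetric])
  also have "\<dots> \<le> (\<Prod>i\<in>UNIV. (1 + (\<xi> $ i)\<^sup>2) powr (- (s / real CARD('n))))"
  proof (intro prod_mono conjI)
    fix i
    have "(\<xi> $ i)\<^sup>2 \<le> (norm \<xi>)\<^sup>2"
      using power_mono[OF component_le_norm_cart[of \<xi> i], of 2] by simp
    then show "(1 + (norm \<xi>)\<^sup>2) powr (- (s / real CARD('n))) \<le> (1 + (\<xi> $ i)\<^sup>2) powr (- (s / real CARD('n)))"
      using assms by (intro powr_mono2') (auto simp: add_pos_nonneg)
  qed simp
  finally show ?thesis .
qed

lemma one_plus_square_powr_le:
  fixes y p :: real
  assumes "0 \<le> p"
  shows "(1 + y\<^sup>2) powr (- p) \<le> 2 powr p * (1 + \<bar>y\<bar>) powr (- (2 * p))"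
proof -
  have "(1 + \<bar>y\<bar>)\<^sup>2 / 2 \<le> 1 + y\<^sup>2"
    using sum_squares_bound[of 1 "\<bar>y\<bar>"] by (simp add: power2_eq_square field_simps)
  then have "(1 + y\<^sup>2) powr (- p) \<le> ((1 + \<bar>y\<bar>)\<^sup>2 / 2) powr (- p)"
    using assms by (intro powr_mono2') (auto simp: add_pos_nonneg zero_less_power2)
  also have "\<dots> = 2 powr p * ((1 + \<bar>y\<bar>)\<^sup>2) powr (- p)"
    by (simp add: powr_divide powr_minus field_simps)
  also have "((1 + \<bar>y\<bar>)\<^sup>2) powr (- p) = (1 + \<bar>y\<bar>) powr (- (2 * p))"
    by (simp add: powr_powr flip: powr_numeral)
  finally show ?thesis .
qed

lemma nn_integral_one_plus_square_powr:
  fixes p :: real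
  assumes p: "1 / 2 < p"
  shows "(\<integral>\<^sup>+y. ennreal ((1 + y\<^sup>2) powr (- p)) \<partial>lborel) < \<infinity>"
proof -
  let ?f = "\<lambda>y::real. ennreal ((1 + y\<^sup>2) powr (- p))"
  let ?g = "\<lambda>y::real. 2 powr p * (1 + y) powr (- (2 * p))"
  \<comment> \<open>On the half-line compare with \<open>(1 + y) powr (- 2p)\<close>, whose antiderivative vanishes at infinity since \<open>2p > 1\<close>.\<close>
  have pos: "(\<integral>\<^sup>+y. ?f y * indicator {0..} y \<partial>lborel) < \<infinity>"
  proof -
    let ?F = "\<lambda>y::real. 2 powr p * ((1 + y) powr (1 - 2 * p) / (1 - 2 * p))"
    have "(\<integral>\<^sup>+y. ?f y * indicator {0..} y \<partial>lborel) \<le> (\<integral>\<^sup>+y. ennreal (?g y) * indicator {0..} y \<partial>lborel)"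
      using one_plus_square_powr_le[of p] p
      by (intro nn_integral_mono) (auto simp: indicator_def intro!: ennreal_leI split: if_splits, metis abs_of_nonneg)
    also have "\<dots> = ennreal (0 - ?F 0)"
    proof (rule nn_integral_FTC_atLeast)
      show "(?F has_real_derivative ?g y) (at y)" if "0 \<le> y" for y
      proof -
        have "((\<lambda>y. 2 powr p * ((1 + y) powr q / q)) has_real_derivative 2 powr p * (1 + y) powr (q - 1)) (at y)"
          if "q \<noteq> 0" for q
          using that \<open>0 \<le> y\<close> by (auto intro!: derivative_eq_intros)
        from this[of "1 - 2 * p"] show ?thesis using p by simp
      qed
      have "((\<lambda>y. (1 + y) powr (1 - 2 * p)) \<longlongrightarrow> 0) at_top"
        using p by (intro tendsto_neg_powr filterlim_tendsto_add_at_top[OF tendsto_const] filterlim_ident) auto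
      from tendsto_mult[OF tendsto_const this, of "2 powr p / (1 - 2 * p)"]
      show "(?F \<longlongrightarrow> 0) at_top" by (simp add: field_simps)
    qed auto
    finally show ?thesis
      by (simp add: ennreal_less_top le_less_trans)
  qed
  have neg: "(\<integral>\<^sup>+y. ?f y * indicator {..0} y \<partial>lborel) = (\<integral>\<^sup>+y. ?f y * indicator {0..} y \<partial>lborel)"
    by (subst nn_integral_real_affine[where c = "-1" and t = 0])
       (auto intro!: nn_integral_cong simp: indicator_def)
  have "(\<integral>\<^sup>+y. ?f y \<partial>lborel) \<le> (\<integral>\<^sup>+y. ?f y * indicator {0..} y + ?f y * indicator {..0} y \<partial>lborel)"
    by (intro nn_integral_mono) (auto simp: indicator_def)
  also have "\<dots> = (\<integral>\<^sup>+y. ?f y * indicator {0..} y \<partial>lborel) + (\<integral>\<^sup>+y. ?f y * indicator {..0} y \<partial>lborel)"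
    by (intro nn_integral_add) auto
  also have "\<dots> < \<infinity>" using pos unfolding neg by simp
  finally show ?thesis .
qed

lemma abs_summable_one_plus_square_powr:
  fixes p :: real
  assumes p: "1 / 2 < p"
  shows "Infinite_Set_Sum.abs_summable_on (\<lambda>k::int. (1 + (2 * pi * of_int k)\<^sup>2) powr (- p)) UNIV"
proof -
  let ?f = "\<lambda>k::int. (1 + (2 * pi * of_int k)\<^sup>2) powr (- p)"
  have "summable (\<lambda>n::nat. ?f (int n))"
  proof (rule summable_comparison_test)
    show "summable (\<lambda>n. real n powr (- (2 * p)))"
      using p by (simp add: summable_real_powr_iff)
    have "?f (int n) \<le> real n powr (- (2 * p))" if "n \<ge> 1" for n
    proof -
      have "?f (int n) \<le> ((real n)\<^sup>2) powr (- p)"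
      proof (rule powr_mono2')
        have "real n \<le> 2 * pi * real n"
          using pi_ge_two that by (simp add: mult_le_cancel_right1)
        then have "(real n)\<^sup>2 \<le> (2 * pi * real n)\<^sup>2"
          by (intro power_mono) auto
        then show "(real n)\<^sup>2 \<le> 1 + (2 * pi * of_int (int n))\<^sup>2"
            unfolding of_int_of_nat_eq by linarith
      qed (use p that in auto)
      also have "\<dots> = real n powr (- (2 * p))"
        using that by (simp add: powr_powr flip: powr_numeral)
      finally show ?thesis .
    qed
    then show "\<exists>N. \<forall>n\<ge>N. norm (?f (int n)) \<le> real n powr (- (2 * p))"
      by (intro exI[of _ 1]) simp
  qed
  then have nat: "Infinite_Set_Sum.abs_summable_on (\<lambda>n::nat. ?f (int n)) UNIV"
    by (simp add: abs_summable_on_nat_iff')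
  have "Infinite_Set_Sum.abs_summable_on ?f (range int)"
    using nat by (subst abs_summable_on_reindex_iff[symmetric]) (auto simp: inj_on_def)
  moreover have "Infinite_Set_Sum.abs_summable_on ?f (range (\<lambda>n. - int n))"
    using nat by (subst abs_summable_on_reindex_iff[symmetric]) (auto simp: inj_on_def)
  ultimately have "Infinite_Set_Sum.abs_summable_on ?f (range int \<union> range (\<lambda>n. - int n))"
    by (rule abs_summable_on_union)
  moreover have "range int \<union> range (\<lambda>n. - int n) = UNIV"
    by (auto, metis int_cases2 rangeI)
  ultimately show ?thesis by simp
qed

text \<open>On the torus the frequencies form a lattice, and the product bound is summed instead of integrated.\<close>

lemma nn_integral_bessel_weight:
  fixes s :: real
  assumes s: "real CARD('n) / 2 < s"
  shows "(\<integral>\<^sup>+\<xi>. ennreal ((1 + (norm \<xi>)\<^sup>2) powr (- s)) \<partial>(frequency_measure \<Omega> :: (real^'n) measure)) < \<infinity>"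
proof -
  define p where "p = s / real CARD('n)"
  have p: "1 / 2 < p" using s by (simp add: p_def field_simps)
  have s0: "0 \<le> s" using s by (rule le_less_trans[THEN less_imp_le, rotated]) simp
  have le: "ennreal ((1 + (norm \<xi>)\<^sup>2) powr (- s)) \<le> ennreal (\<Prod>i\<in>UNIV. (1 + (\<xi> $ i)\<^sup>2) powr (- p))" for \<xi> :: "real^'n"
    unfolding p_def by (intro ennreal_leI bessel_weight_le_prod s0)
  show ?thesis
  proof (cases \<Omega>)
    case WholeSpace
    let ?h = "\<lambda>y::real. (1 + y\<^sup>2) powr (- p)"
    have "integrable lborel ?h"
      using nn_integral_one_plus_square_powr[OF p] by (intro integrableI_bounded) auto
    then have "has_bochner_integral lborel ?h (integral\<^sup>L lborel ?h)"
      by (rule has_bochner_integral_integrable)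
    from has_bochner_integral_vec_prod[of "\<lambda>_. ?h", OF this]
    have int: "integrable lborel (\<lambda>\<xi>::real^'n. \<Prod>i\<in>UNIV. ?h (\<xi> $ i))"
      by (rule integrable.intros)
    have "(\<integral>\<^sup>+\<xi>. ennreal ((1 + (norm \<xi>)\<^sup>2) powr (- s)) \<partial>(lborel :: (real^'n) measure))
        \<le> (\<integral>\<^sup>+\<xi>. ennreal (\<Prod>i\<in>UNIV. ?h (\<xi> $ i)) \<partial>(lborel :: (real^'n) measure))"
      by (intro nn_integral_mono le)
    also have "\<dots> < \<infinity>"
      using int by (subst (asm) integrable_iff_bounded) (simp add: prod_nonneg abs_prod)
    finally show ?thesis
      unfolding WholeSpace frequency_measure_def
      by (simp add: nn_integral_density nn_integral_cmult ennreal_mult_less_top)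
  next
    case Torus
    let ?h = "\<lambda>k::int. (1 + (2 * pi * of_int k)\<^sup>2) powr (- p)"
    have "Infinite_Set_Sum.abs_summable_on (\<lambda>g. \<Prod>i\<in>(UNIV::'n set). ?h (g i)) (PiE UNIV (\<lambda>_. UNIV))"
      by (intro abs_summable_on_prod_PiE abs_summable_one_plus_square_powr p) auto
    then have int: "integrable (count_space UNIV) (\<lambda>g. \<Prod>i\<in>(UNIV::'n set). ?h (g i))"
      by (simp add: Infinite_Set_Sum.abs_summable_on_def)
    have bij: "bij_betw (\<lambda>k::int^'n. ($) k) UNIV UNIV"
      by (rule bij_betwI[where g = "vec_lambda"]) (auto simp: vec_nth_inverse)
    have "(\<integral>\<^sup>+\<xi>. ennreal ((1 + (norm \<xi>)\<^sup>2) powr (- s)) \<partial>(frequency_measure \<Omega> :: (real^'n) measure))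
        \<le> (\<integral>\<^sup>+k. ennreal (\<Prod>i\<in>UNIV. ?h (k $ i)) \<partial>count_space (UNIV :: (int^'n) set))"
      unfolding Torus frequency_measure_def
      by (simp add: nn_integral_distr) (intro nn_integral_mono order_trans[OF le], simp)
    also have "\<dots> = (\<integral>\<^sup>+g. ennreal (\<Prod>i\<in>(UNIV::'n set). ?h (g i)) \<partial>count_space UNIV)"
      by (rule nn_integral_bij_count_space[OF bij])
    also have "\<dots> < \<infinity>"
      using int by (subst (asm) integrable_iff_bounded) (simp add: prod_nonneg abs_prod)
    finally show ?thesis .
  qed
qed

lemma ennreal_power2_le_imp_le:
  assumes "x\<^sup>2 \<le> (ennreal c)\<^sup>2" and "0 \<le> c"
  shows "x \<le> ennreal c"
proof (cases x)
  case (real a)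
  then have "a\<^sup>2 \<le> c\<^sup>2" using assms by (simp add: ennreal_power)
  then show ?thesis using real assms(2) power2_le_imp_le by (auto intro: ennreal_leI)
next
  case top
  then show ?thesis using assms by (simp add: power2_eq_square top_unique ennreal_mult[symmetric])
qed

text \<open>Cauchy--Schwarz against the weight bounds $\|\hat g\|_{L^1}$ by $\sqrt A\,\|g\|_{H^s}$, and
  $|g(x)|\le\|\hat g\|_{L^1}$ by Fourier inversion.\<close>

lemma AE_Hs_bounded_le:
  fixes g :: "real^'n::finite \<Rightarrow> real"
  assumes g: "Hs_bounded \<Omega> s b g"
    and A: "(\<integral>\<^sup>+\<xi>. ennreal ((1 + (norm \<xi>)\<^sup>2) powr (- s)) \<partial>(frequency_measure \<Omega> :: (real^'n) measure)) \<le> ennreal A"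
    and "0 \<le> A"
  shows "AE x in space_measure \<Omega>. \<bar>g x\<bar> \<le> sqrt A * \<bar>b\<bar>"
proof -
  let ?\<mu> = "frequency_measure \<Omega> :: (real^'n) measure"
  have sets: "sets ?\<mu> = sets borel"
    by (cases \<Omega>) (simp_all add: frequency_measure_def)
  obtain F :: "real^'n \<Rightarrow> complex" where F: "F \<in> borel_measurable borel"
      and Fb: "(\<integral>\<^sup>+\<xi>. ennreal ((1 + (norm \<xi>)\<^sup>2) powr s * (cmod (F \<xi>))\<^sup>2) \<partial>?\<mu>) \<le> ennreal (b\<^sup>2)"
      and inv: "AE x in space_measure \<Omega>. complex_of_real (g x) = (\<integral>\<xi>. F \<xi> * cis (\<xi> \<bullet> x) \<partial>?\<mu>)"
    using g unfolding Hs_bounded_def by blast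
  have Fm[measurable]: "F \<in> borel_measurable ?\<mu>"
    using F measurable_cong_sets[OF sets refl] by blast
  have wm[measurable]: "(\<lambda>\<xi>::real^'n. (1 + (norm \<xi>)\<^sup>2) powr q) \<in> borel_measurable ?\<mu>" for q
    unfolding measurable_cong_sets[OF sets refl] by measurable
  \<comment> \<open>Split \<open>\<bar>F\<bar>\<close> as the square root of the inverse weight times that of the weighted density.\<close>
  let ?u = "\<lambda>\<xi>::real^'n. ennreal ((1 + (norm \<xi>)\<^sup>2) powr (- s / 2))"
  let ?w = "\<lambda>\<xi>::real^'n. ennreal ((1 + (norm \<xi>)\<^sup>2) powr (s / 2) * cmod (F \<xi>))"
  have uw: "?u \<xi> * ?w \<xi> = ennreal (cmod (F \<xi>))" for \<xi>
  proof -
    have "(1 + (norm \<xi>)\<^sup>2) powr (- s / 2) * (1 + (norm \<xi>)\<^sup>2) powr (s / 2) = 1"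
      by (simp add: powr_add[symmetric] add_pos_nonneg less_imp_neq[symmetric])
    then show ?thesis by (simp add: ennreal_mult[symmetric] mult.assoc[symmetric])
  qed
  have sq: "((1 + (norm \<xi>)\<^sup>2) powr (q / 2))\<^sup>2 = (1 + (norm \<xi>)\<^sup>2) powr q" for q and \<xi> :: "real^'n"
    by (simp add: power2_eq_square powr_add[symmetric])
  have "(\<integral>\<^sup>+\<xi>. ennreal (cmod (F \<xi>)) \<partial>?\<mu>)\<^sup>2 = (\<integral>\<^sup>+\<xi>. ?u \<xi> * ?w \<xi> \<partial>?\<mu>)\<^sup>2"
    by (simp only: uw)
  also have "\<dots> \<le> (\<integral>\<^sup>+\<xi>. (?u \<xi>)\<^sup>2 \<partial>?\<mu>) * (\<integral>\<^sup>+\<xi>. (?w \<xi>)\<^sup>2 \<partial>?\<mu>)"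
    by (intro Cauchy_Schwarz_nn_integral measurable_compose[OF _ measurable_ennreal]
        borel_measurable_times wm measurable_compose[OF Fm borel_measurable_norm])
  also have "(\<integral>\<^sup>+\<xi>. (?u \<xi>)\<^sup>2 \<partial>?\<mu>) = (\<integral>\<^sup>+\<xi>. ennreal ((1 + (norm \<xi>)\<^sup>2) powr (- s)) \<partial>?\<mu>)"
    by (intro nn_integral_cong) (use sq[of _ "- s"] in \<open>simp add: ennreal_power\<close>)
  also have "(\<integral>\<^sup>+\<xi>. (?w \<xi>)\<^sup>2 \<partial>?\<mu>) = (\<integral>\<^sup>+\<xi>. ennreal ((1 + (norm \<xi>)\<^sup>2) powr s * (cmod (F \<xi>))\<^sup>2) \<partial>?\<mu>)"
    by (intro nn_integral_cong) (simp add: ennreal_power sq power_mult_distrib)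
  also have "(\<integral>\<^sup>+\<xi>. ennreal ((1 + (norm \<xi>)\<^sup>2) powr (- s)) \<partial>?\<mu>) * \<dots> \<le> ennreal A * ennreal (b\<^sup>2)"
    by (intro mult_mono A Fb) auto
  also have "\<dots> = (ennreal (sqrt A * \<bar>b\<bar>))\<^sup>2"
    using \<open>0 \<le> A\<close> by (simp add: ennreal_power power_mult_distrib ennreal_mult)
  finally have L1: "(\<integral>\<^sup>+\<xi>. ennreal (cmod (F \<xi>)) \<partial>?\<mu>) \<le> ennreal (sqrt A * \<bar>b\<bar>)"
    using \<open>0 \<le> A\<close> by (intro ennreal_power2_le_imp_le) auto
  show ?thesis
    using inv
  proof (rule AE_mp, intro AE_I2 impI)
    fix x assume eq: "complex_of_real (g x) = (\<integral>\<xi>. F \<xi> * cis (\<xi> \<bullet> x) \<partial>?\<mu>)"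
    show "\<bar>g x\<bar> \<le> sqrt A * \<bar>b\<bar>"
    proof (cases "integrable ?\<mu> (\<lambda>\<xi>. F \<xi> * cis (\<xi> \<bullet> x))")
      case True
      have "ennreal \<bar>g x\<bar> = ennreal (norm (\<integral>\<xi>. F \<xi> * cis (\<xi> \<bullet> x) \<partial>?\<mu>))"
        unfolding eq[symmetric] by simp
      also have "\<dots> \<le> (\<integral>\<^sup>+\<xi>. ennreal (norm (F \<xi> * cis (\<xi> \<bullet> x))) \<partial>?\<mu>)"
        by (rule integral_norm_bound_ennreal[OF True])
      also have "\<dots> = (\<integral>\<^sup>+\<xi>. ennreal (cmod (F \<xi>)) \<partial>?\<mu>)"
        by (simp add: norm_mult)
      finally have "ennreal \<bar>g x\<bar> \<le> ennreal (sqrt A * \<bar>b\<bar>)" using L1 by (rule order_trans)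
      then show ?thesis using \<open>0 \<le> A\<close> by simp
    next
      \<comment> \<open>The Bochner integral of a non-integrable function is \<open>0\<close>.\<close>
      case False
      then have "g x = 0" using eq by (simp add: not_integrable_integral_eq)
      then show ?thesis using \<open>0 \<le> A\<close> by simp
    qed
  qed
qed

section \<open>Moments of a Maxwellian\<close>

text \<open>Central moments of the normal distribution with standard deviation $\sigma$; for $m=2k$ the value
  is $(2k-1)!!\,\sigma^{2k}$.\<close>
definition gaussian_moment :: "real \<Rightarrow> nat \<Rightarrow> real" where
  "gaussian_moment \<sigma> m =
     (if even m then fact m / ((2 / \<sigma>\<^sup>2) ^ (m div 2) * fact (m div 2)) else 0)"

lemma gaussian_moment_values:
  "gaussian_moment \<sigma> 0 = 1" "gaussian_moment \<sigma> (Suc 0) = 0"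
  "gaussian_moment \<sigma> 2 = \<sigma>\<^sup>2" "gaussian_moment \<sigma> 4 = 3 * (\<sigma>\<^sup>2)\<^sup>2"
  by (simp_all add: gaussian_moment_def fact_numeral power2_eq_square field_simps)

lemma has_bochner_integral_gaussian_moment:
  assumes "0 < \<sigma>"
  shows "has_bochner_integral lborel (\<lambda>y. normal_density \<mu> \<sigma> y * (y - \<mu>) ^ m) (gaussian_moment \<sigma> m)"
proof (cases "even m")
  case True
  then obtain k where "m = 2 * k" by (elim evenE)
  then show ?thesis
    using normal_moment_even[OF assms, of \<mu> k] by (simp add: gaussian_moment_def)
next
  case False
  then obtain k where "m = 2 * k + 1" by (elim oddE)
  then show ?thesis
    using normal_moment_odd[OF assms, of \<mu> k] by (simp add: gaussian_moment_def)
qed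

lemma maxwellian_eq_prod_normal_density:
  fixes w :: "'n::finite state"
  assumes "0 < Rgas" "0 < temp w"
  shows "maxwellian Rgas w v =
    dens w * (\<Prod>i\<in>UNIV. normal_density (vel w $ i) (sqrt (Rgas * temp w)) (v $ i))"
proof -
  let ?a = "Rgas * temp w"
  have a: "0 < ?a" using assms by simp
  have sq: "(norm (v - vel w))\<^sup>2 = (\<Sum>i\<in>UNIV. (v $ i - vel w $ i)\<^sup>2)"
    unfolding power2_norm_eq_inner by (simp add: inner_vec_def power2_eq_square)
  have "sqrt (2 * pi * ?a) ^ CARD('n) = ((2 * pi * ?a) powr (1 / 2)) powr real CARD('n)"
    using a by (subst powr_realpow) (simp_all add: powr_half_sqrt)
  then have "(1 / sqrt (2 * pi * ?a)) ^ CARD('n) = 1 / (2 * pi * ?a) powr (real CARD('n) / 2)"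
    by (simp add: power_divide powr_powr)
  moreover have "(\<Prod>i\<in>UNIV. normal_density (vel w $ i) (sqrt ?a) (v $ i))
      = (\<Prod>i\<in>UNIV. 1 / sqrt (2 * pi * ?a) * exp (- (v $ i - vel w $ i)\<^sup>2 / (2 * ?a)))"
    using a by (simp add: normal_density_def)
  moreover have "\<dots> = (1 / sqrt (2 * pi * ?a)) ^ CARD('n)
      * exp (- (\<Sum>i\<in>UNIV. (v $ i - vel w $ i)\<^sup>2) / (2 * ?a))"
    unfolding prod.distrib prod_constant
    by (simp add: exp_sum[symmetric] sum_negf sum_divide_distrib)
  ultimately show ?thesis
    unfolding maxwellian_def sq by (simp add: mult.assoc)
qed

lemma has_bochner_integral_maxwellian_moment:
  fixes w :: "'n::finite state"
  assumes "0 < Rgas" "0 < temp w"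
  shows "has_bochner_integral lborel
     (\<lambda>v. maxwellian Rgas w v * (\<Prod>i\<in>UNIV. (v $ i - vel w $ i) ^ e i))
     (dens w * (\<Prod>i\<in>UNIV. gaussian_moment (sqrt (Rgas * temp w)) (e i)))"
proof -
  have "0 < sqrt (Rgas * temp w)" using assms by simp
  from has_bochner_integral_vec_prod[OF has_bochner_integral_gaussian_moment[OF this]]
  have "has_bochner_integral lborel
      (\<lambda>v::real^'n. \<Prod>i\<in>UNIV. normal_density (vel w $ i) (sqrt (Rgas * temp w)) (v $ i) * (v $ i - vel w $ i) ^ e i)
      (\<Prod>i\<in>UNIV. gaussian_moment (sqrt (Rgas * temp w)) (e i))" .
  from has_bochner_integral_mult_right[OF this, of "dens w"] show ?thesis
    by (simp add: maxwellian_eq_prod_normal_density[OF assms] prod.distrib mult.assoc)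
qed

text \<open>The monomials $(v_i-u_i)^m(v_j-u_j)^m$ are written as products over all coordinates, so that the
  cases $i=j$ and $i\ne j$ share one multi-index.\<close>

lemma prod_power_delta:
  fixes a :: "'n::finite \<Rightarrow> real"
  shows "(\<Prod>k\<in>UNIV. a k ^ ((if k = i then m else 0) + (if k = j then l else 0))) = a i ^ m * a j ^ l"
proof -
  have "(\<Prod>k\<in>UNIV. a k ^ (if k = q then r else 0)) = a q ^ r" for q r
  proof -
    have "(\<Prod>k\<in>UNIV. a k ^ (if k = q then r else 0)) = (\<Prod>k\<in>UNIV. if k = q then a k ^ r else 1)"
      by (intro prod.cong) auto
    then show ?thesis by simp
  qed
  then show ?thesis by (simp add: power_add prod.distrib)
qed

lemma prod_gaussian_moment_delta:
  fixes i j :: "'n::finite"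
  shows "(\<Prod>k\<in>UNIV. gaussian_moment \<sigma> ((if k = i then m else 0) + (if k = j then m else 0))) =
    (if i = j then gaussian_moment \<sigma> (m + m) else (gaussian_moment \<sigma> m)\<^sup>2)"
proof (cases "i = j")
  case True
  have "(\<Prod>k\<in>UNIV. gaussian_moment \<sigma> ((if k = i then m else 0) + (if k = i then m else 0)))
      = (\<Prod>k\<in>UNIV. if k = i then gaussian_moment \<sigma> (m + m) else 1)"
    by (intro prod.cong) (auto simp: gaussian_moment_values)
  then show ?thesis using True by simp
next
  case False
  have "(\<Prod>k\<in>UNIV. gaussian_moment \<sigma> ((if k = i then m else 0) + (if k = j then m else 0)))
      = (\<Prod>k\<in>UNIV. (if k = i then gaussian_moment \<sigma> m else 1) * (if k = j then gaussian_moment \<sigma> m else 1))"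
    using False by (intro prod.cong) (auto simp: gaussian_moment_values)
  then show ?thesis using False by (simp add: prod.distrib power2_eq_square)
qed

text \<open>Isotropy: the off-diagonal entries vanish because they contain a first central moment.\<close>

lemma has_bochner_integral_pressure_maxwellian:
  fixes w :: "'n::finite state"
  assumes "0 < Rgas" "0 < temp w"
  shows "has_bochner_integral lborel
     (\<lambda>v. (v $ i - vel w $ i) * (v $ j - vel w $ j) * maxwellian Rgas w v)
     (if i = j then dens w * (Rgas * temp w) else 0)"
  using has_bochner_integral_maxwellian_moment[OF assms,
      of "\<lambda>k. (if k = i then 1 else 0) + (if k = j then 1 else 0)"] assms
  by (simp add: prod_power_delta prod_gaussian_moment_delta gaussian_moment_values numeral_2_eq_2[symmetric] ac_simps split: if_splits)

lemma nn_integral_fourth_moment_maxwellian: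
  fixes w :: "'n::finite state"
  assumes "0 < Rgas" "positive_state w"
  shows "(\<integral>\<^sup>+v. ennreal (((v $ i - vel w $ i) * (v $ j - vel w $ j))\<^sup>2 * maxwellian Rgas w v) \<partial>lborel)
     \<le> ennreal (3 * dens w * (Rgas * temp w)\<^sup>2)"
proof -
  have w: "0 < temp w" "0 < dens w" using assms by (auto simp: positive_state_def)
  let ?c = "dens w * (if i = j then 3 * (Rgas * temp w)\<^sup>2 else (Rgas * temp w)\<^sup>2)"
  have "has_bochner_integral lborel
      (\<lambda>v. ((v $ i - vel w $ i) * (v $ j - vel w $ j))\<^sup>2 * maxwellian Rgas w v) ?c"
    using has_bochner_integral_maxwellian_moment[OF assms(1) w(1),
        of "\<lambda>k. (if k = i then 2 else 0) + (if k = j then 2 else 0)"] assms(1) w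
    by (simp add: prod_power_delta prod_gaussian_moment_delta gaussian_moment_values power_mult_distrib ac_simps split: if_splits)
  then have "(\<integral>\<^sup>+v. ennreal (((v $ i - vel w $ i) * (v $ j - vel w $ j))\<^sup>2 * maxwellian Rgas w v) \<partial>lborel) = ennreal ?c"
    using w by (intro nn_integral_eq_integral[THEN trans])
      (auto simp: has_bochner_integral_iff maxwellian_def)
  also have "\<dots> \<le> ennreal (3 * dens w * (Rgas * temp w)\<^sup>2)"
    using w by (intro ennreal_leI) (auto simp: mult.assoc mult_le_cancel_left)
  finally show ?thesis .
qed

lemma maxwellian_pos: "positive_state w \<Longrightarrow> 0 < Rgas \<Longrightarrow> 0 < maxwellian Rgas w v"
  by (auto simp: maxwellian_def positive_state_def)

lemma borel_measurable_maxwellian [measurable]: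
  fixes w :: "'a \<Rightarrow> 'n::finite state"
  assumes [measurable]: "w \<in> borel_measurable M" "v \<in> borel_measurable M"
  shows "(\<lambda>z. maxwellian Rgas (w z) (v z)) \<in> borel_measurable M"
proof -
  have [measurable]: "(\<lambda>z. dens (w z)) \<in> borel_measurable M" 
     "(\<lambda>z. vel (w z)) \<in> borel_measurable M" "(\<lambda>z. temp (w z)) \<in> borel_measurable M"
    using assms(1) by (auto simp: borel_prod[symmetric] intro: measurable_compose)
  show ?thesis unfolding maxwellian_def by measurable
qed

section \<open>Stress of a perturbed Maxwellian\<close>

text \<open>Cauchy--Schwarz with the integrand split as $(q\,M^{1/2})(r\,M^{-1/2})$.\<close>

lemma pressure_integral_le:
  fixes w :: "'n::finite state" and r :: "real^'n \<Rightarrow> real" and i j :: 'n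
  assumes R: "0 < Rgas" and w: "positive_state w" and [measurable]: "r \<in> borel_measurable borel"
  defines "q \<equiv> \<lambda>v. (v $ i - vel w $ i) * (v $ j - vel w $ j)"
  shows "(\<integral>\<^sup>+v. ennreal \<bar>q v * r v\<bar> \<partial>lborel)\<^sup>2
    \<le> ennreal (3 * dens w * (Rgas * temp w)\<^sup>2) *
       (\<integral>\<^sup>+v. ennreal ((r v)\<^sup>2 / maxwellian Rgas w v) \<partial>lborel)"
proof -
  let ?M = "maxwellian Rgas w"
  have M: "0 < ?M v" for v using maxwellian_pos[OF w R] .
  have [measurable]: "q \<in> borel_measurable borel" unfolding q_def by measurable
  have "ennreal \<bar>q v * r v\<bar> = ennreal (\<bar>q v\<bar> * sqrt (?M v)) * ennreal (\<bar>r v\<bar> / sqrt (?M v))" for v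
    using M[of v] by (simp add: ennreal_mult[symmetric] abs_mult)
  then have "(\<integral>\<^sup>+v. ennreal \<bar>q v * r v\<bar> \<partial>lborel)\<^sup>2
    = (\<integral>\<^sup>+v. ennreal (\<bar>q v\<bar> * sqrt (?M v)) * ennreal (\<bar>r v\<bar> / sqrt (?M v)) \<partial>lborel)\<^sup>2"
    by simp
  also have "\<dots> \<le> (\<integral>\<^sup>+v. (ennreal (\<bar>q v\<bar> * sqrt (?M v)))\<^sup>2 \<partial>lborel) *
      (\<integral>\<^sup>+v. (ennreal (\<bar>r v\<bar> / sqrt (?M v)))\<^sup>2 \<partial>lborel)"
    by (rule Cauchy_Schwarz_nn_integral) measurable
  also have "(\<integral>\<^sup>+v. (ennreal (\<bar>q v\<bar> * sqrt (?M v)))\<^sup>2 \<partial>lborel) = (\<integral>\<^sup>+v. ennreal ((q v)\<^sup>2 * ?M v) \<partial>lborel)"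
    using M by (intro nn_integral_cong) (simp add: ennreal_power power_mult_distrib less_imp_le)
  also have "(\<integral>\<^sup>+v. (ennreal (\<bar>r v\<bar> / sqrt (?M v)))\<^sup>2 \<partial>lborel) = (\<integral>\<^sup>+v. ennreal ((r v)\<^sup>2 / ?M v) \<partial>lborel)"
    using M by (intro nn_integral_cong) (simp add: ennreal_power power_divide less_imp_le)
  also have "(\<integral>\<^sup>+v. ennreal ((q v)\<^sup>2 * ?M v) \<partial>lborel) * \<dots> \<le> ennreal (3 * dens w * (Rgas * temp w)\<^sup>2) * \<dots>"
    unfolding q_def by (intro mult_right_mono nn_integral_fourth_moment_maxwellian R w) simp
  finally show ?thesis .
qed

text \<open>Each $P_{ij}[r]$ is bounded by the square root of \<open>pressure_integral_le\<close>; the trace term is a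
  mean of $d$ such entries. The two terms together give $12=2^2\cdot3$. The right-hand side may be
  infinite, so the bound holds for every $x$ and can be integrated directly.\<close>

lemma deviatoric_stress_le:
  fixes w :: "'n::finite state" and g r :: "real^'n \<Rightarrow> real"
  assumes R: "0 < Rgas" and w: "positive_state w"
    and rm[measurable]: "r \<in> borel_measurable borel"
    and g: "AE v in lborel. g v = maxwellian Rgas w v + r v"
    and gm[measurable]: "g \<in> borel_measurable borel"
  shows "ennreal ((deviatoric_stress (vel w) g i j)\<^sup>2)
    \<le> ennreal (12 * dens w * (Rgas * temp w)\<^sup>2) *
       (\<integral>\<^sup>+v. ennreal ((r v)\<^sup>2 / maxwellian Rgas w v) \<partial>lborel)"
proof (cases "(\<integral>\<^sup>+v. ennreal ((r v)\<^sup>2 / maxwellian Rgas w v) \<partial>lborel)")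
  \<comment> \<open>The constant must be positive here, as \<open>0 * \<infinity> = 0\<close> for extended nonnegative reals.\<close>
  case top
  have "0 < 12 * dens w * (Rgas * temp w)\<^sup>2"
    using R w by (simp add: positive_state_def)
  then show ?thesis using top by (auto simp: ennreal_mult_top)
next
  case (real E)
  have pos: "0 < dens w" "0 < temp w" using w by (auto simp: positive_state_def)
  let ?q = "\<lambda>i j v. (v $ i - vel w $ i) * (v $ j - vel w $ j)"
  let ?S = "sqrt (3 * dens w * (Rgas * temp w)\<^sup>2 * E)"
  let ?P = "\<lambda>i j. pressure_tensor (vel w) r i j"
  have L1: "(\<integral>\<^sup>+v. ennreal \<bar>?q i j v * r v\<bar> \<partial>lborel) \<le> ennreal ?S" for i j
  proof -
    have "(\<integral>\<^sup>+v. ennreal \<bar>?q i j v * r v\<bar> \<partial>lborel)\<^sup>2 \<le> ennreal (3 * dens w * (Rgas * temp w)\<^sup>2) * ennreal E"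
      using pressure_integral_le[OF R w rm, of i j] real(2) by simp
    also have "\<dots> = (ennreal ?S)\<^sup>2"
      using pos R real(1) by (simp add: ennreal_power ennreal_mult)
    finally show ?thesis
      using pos real(1) by (intro ennreal_power2_le_imp_le) auto
  qed
  have int: "integrable lborel (\<lambda>v. ?q i j v * r v)" for i j
    using L1[of i j] by (intro integrableI_bounded) (auto simp: ennreal_less_top le_less_trans)
  have Ple: "\<bar>?P i j\<bar> \<le> ?S" for i j
  proof -
    have "ennreal \<bar>?P i j\<bar> \<le> (\<integral>\<^sup>+v. ennreal \<bar>?q i j v * r v\<bar> \<partial>lborel)"
      using integral_norm_bound_ennreal[OF int[of i j]] by (simp add: pressure_tensor_def)
    then have "ennreal \<bar>?P i j\<bar> \<le> ennreal ?S" using L1[of i j] by (rule order_trans)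
    then show ?thesis using pos real(1) by simp
  qed
  \<comment> \<open>The Maxwellian adds a multiple of the identity, which the deviator removes.\<close>
  have Pg: "pressure_tensor (vel w) g i j = (if i = j then dens w * (Rgas * temp w) else 0) + ?P i j" for i j
  proof -
    note M = has_bochner_integral_pressure_maxwellian[OF R pos(2), of i j, unfolded has_bochner_integral_iff]
    have "pressure_tensor (vel w) g i j
        = (\<integral>v. ?q i j v * maxwellian Rgas w v + ?q i j v * r v \<partial>lborel)"
      unfolding pressure_tensor_def
      by (intro integral_cong_AE) (use g in \<open>auto simp: distrib_left elim: eventually_mono\<close>)
    also have "\<dots> = (if i = j then dens w * (Rgas * temp w) else 0) + ?P i j"
      using M int[of i j] by (subst Bochner_Integration.integral_add) (auto simp: pressure_tensor_def)
    finally show ?thesis .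
  qed
  have "deviatoric_stress (vel w) g i j = deviatoric_stress (vel w) r i j"
    unfolding deviatoric_stress_def by (simp add: Pg sum.distrib field_simps)
  also have "\<bar>\<dots>\<bar> \<le> \<bar>?P i j\<bar> + \<bar>1 / real CARD('n) * (\<Sum>k\<in>UNIV. ?P k k)\<bar>"
    using abs_triangle_ineq4[of "?P i j" "1 / real CARD('n) * (\<Sum>k\<in>UNIV. ?P k k)"]
    unfolding deviatoric_stress_def by (cases "i = j") simp_all
  also have "\<bar>1 / real CARD('n) * (\<Sum>k\<in>UNIV. ?P k k)\<bar> \<le> 1 / real CARD('n) * (\<Sum>k\<in>(UNIV::'n set). ?S)"
    unfolding abs_mult by (intro mult_mono order_trans[OF sum_abs] sum_mono Ple) auto
  also have "\<dots> = ?S" by simp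
  finally have "\<bar>deviatoric_stress (vel w) g i j\<bar> \<le> 2 * ?S"
    using Ple[of i j] by simp
  then have "(deviatoric_stress (vel w) g i j)\<^sup>2 \<le> (2 * ?S)\<^sup>2"
    by (rule abs_le_square_iff[THEN iffD1, OF order_trans]) simp
  also have "\<dots> = 12 * dens w * (Rgas * temp w)\<^sup>2 * E"
    using pos real(1) by (simp add: power_mult_distrib)
  finally show ?thesis
    using pos real by (simp add: ennreal_mult[symmetric] ennreal_leI)
qed

lemma sets_space_measure [simp, measurable_cong]: "sets (space_measure \<Omega>) = sets borel"
  by (cases \<Omega>) (simp_all add: space_measure_def)

lemma borel_measurable_deviatoric_stress:
  fixes u :: "real^'n::finite \<Rightarrow> real^'n" and g :: "real^'n \<Rightarrow> real^'n \<Rightarrow> real"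
  assumes u: "u \<in> borel_measurable M"
    and g: "case_prod g \<in> borel_measurable (M \<Otimes>\<^sub>M lborel)"
  shows "(\<lambda>x. deviatoric_stress (u x) (g x) i j) \<in> borel_measurable M"
proof -
  have c: "(\<lambda>y::real^'n. y $ k) \<in> borel_measurable borel" for k
    by (intro borel_measurable_continuous_onI continuous_intros)
  have v: "(\<lambda>z. snd z $ k) \<in> borel_measurable (M \<Otimes>\<^sub>M (lborel :: (real^'n) measure))" for k
    by (rule measurable_compose[OF measurable_snd]) (simp add: c)
  have u': "(\<lambda>z. u (fst z) $ k) \<in> borel_measurable (M \<Otimes>\<^sub>M (lborel :: (real^'n) measure))" for k
    using measurable_compose[OF measurable_compose[OF measurable_fst u] c] .
  have "(\<lambda>x. pressure_tensor (u x) (g x) i j) \<in> borel_measurable M" for i j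
    unfolding pressure_tensor_def
    using u' v g
    by (intro lborel.borel_measurable_lebesgue_integral)
       (auto simp: case_prod_beta intro!: borel_measurable_times borel_measurable_diff)
  then show ?thesis
    unfolding deviatoric_stress_def by (auto intro!: borel_measurable_diff borel_measurable_times borel_measurable_sum)
qed

lemma L2_deviatoric_stress_le:
  fixes w :: "real^'n \<Rightarrow> 'n::finite state" and g r :: "real^'n \<Rightarrow> real^'n \<Rightarrow> real"
  assumes R: "0 < Rgas" and w: "\<And>x. positive_state (w x)" and wm[measurable]: "w \<in> borel_measurable borel"
    and gm: "case_prod g \<in> borel_measurable borel"
    and g: "\<And>x. AE v in lborel. g x v = maxwellian Rgas (w x) v + r x v"
    and r: "L2_bounded (L2x_L2v \<Omega> Rgas w) b (\<lambda>(x, v). r x v)"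
    and D: "AE x in space_measure \<Omega>. dens (w x) \<le> \<rho>m"
    and T: "AE x in space_measure \<Omega>. temp (w x) \<le> Tm"
  shows "L2_bounded (space_measure \<Omega>) (sqrt (12 * \<bar>\<rho>m\<bar>) * (Rgas * \<bar>Tm\<bar>) * b)
    (\<lambda>x. deviatoric_stress (vel (w x)) (g x) i j)"
proof -
  let ?S = "space_measure \<Omega> :: (real^'n) measure"
  let ?\<tau> = "\<lambda>x. deviatoric_stress (vel (w x)) (g x) i j"
  let ?\<nu> = "L2x_L2v \<Omega> Rgas w"
  let ?E = "\<lambda>x. \<integral>\<^sup>+v. ennreal ((r x v)\<^sup>2 / maxwellian Rgas (w x) v) \<partial>lborel"
  define c where "c = 12 * \<bar>\<rho>m\<bar> * (Rgas * \<bar>Tm\<bar>)\<^sup>2"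
  have sets2: "sets (?S \<Otimes>\<^sub>M lborel) = sets (borel :: ((real^'n) \<times> (real^'n)) measure)"
    by (simp add: borel_prod[symmetric] cong: sets_pair_measure_cong)
  have r0: "(\<lambda>(x, v). r x v) \<in> borel_measurable ?\<nu>"
    and ri: "integrable ?\<nu> (\<lambda>z. (case z of (x, v) \<Rightarrow> r x v)\<^sup>2)"
    and rb: "norm_L2 ?\<nu> (\<lambda>(x, v). r x v) \<le> b"
    using r by (auto simp: L2_bounded_def in_L2_def)
  have rm[measurable]: "(\<lambda>(x, v). r x v) \<in> borel_measurable (?S \<Otimes>\<^sub>M lborel)"
    using r0 by (simp add: L2x_L2v_def)
  have gm'[measurable]: "(\<lambda>(x, v). g x v) \<in> borel_measurable (?S \<Otimes>\<^sub>M lborel)"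
    using gm unfolding measurable_cong_sets[OF sets2 refl] .
  have wm'[measurable]: "w \<in> borel_measurable ?S" by simp
  have "vel \<in> borel_measurable (borel :: 'n state measure)"
    by (simp add: borel_prod[symmetric])
  then have um[measurable]: "(\<lambda>x. vel (w x)) \<in> borel_measurable ?S"
    using measurable_compose[OF wm'] by blast
  have \<tau>m[measurable]: "?\<tau> \<in> borel_measurable ?S"
    by (rule borel_measurable_deviatoric_stress) measurable
  have b0: "0 \<le> b" using rb by (rule order_trans[rotated]) (simp add: norm_L2_def)
  have bound: "AE x in ?S. ennreal ((?\<tau> x)\<^sup>2) \<le> ennreal c * ?E x"
    using D T
  proof eventually_elim
    case (elim x)
    have rx: "r x \<in> borel_measurable borel"
      using measurable_Pair2[OF rm, of x] by (simp add: space_measure_def split: spatial_domain.splits)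
    have gx: "g x \<in> borel_measurable borel"
      using measurable_Pair2[OF gm', of x] by (simp add: space_measure_def split: spatial_domain.splits)
    have "0 < dens (w x)" "0 < temp (w x)" using w[of x] by (auto simp: positive_state_def)
    then have "12 * dens (w x) * (Rgas * temp (w x))\<^sup>2 \<le> c"
      unfolding c_def using elim R by (intro mult_mono power_mono) auto
    then have "ennreal (12 * dens (w x) * (Rgas * temp (w x))\<^sup>2) * ?E x \<le> ennreal c * ?E x"
      by (intro mult_right_mono ennreal_leI) auto
    with deviatoric_stress_le[OF R w rx g gx, of i j] show ?case by (rule order_trans)
  qed
  have "(\<integral>\<^sup>+x. ?E x \<partial>?S) = (\<integral>\<^sup>+z. (case z of (x, v) \<Rightarrow> ennreal ((r x v)\<^sup>2 / maxwellian Rgas (w x) v)) \<partial>(?S \<Otimes>\<^sub>M lborel))"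
    by (subst lborel.nn_integral_fst[symmetric]) auto
  also have "\<dots> = (\<integral>\<^sup>+z. ennreal ((case z of (x, v) \<Rightarrow> r x v)\<^sup>2) \<partial>?\<nu>)"
    unfolding L2x_L2v_def
    by (subst nn_integral_density)
       (auto intro!: nn_integral_cong simp: ennreal_mult[symmetric] maxwellian_pos[OF w R] less_imp_le)
  also have "\<dots> = ennreal ((norm_L2 ?\<nu> (\<lambda>(x, v). r x v))\<^sup>2)"
    using ri by (simp add: nn_integral_eq_integral norm_L2_def)
  also have "\<dots> \<le> ennreal (b\<^sup>2)"
    using rb by (intro ennreal_leI power_mono) (auto simp: norm_L2_def)
  finally have E: "(\<integral>\<^sup>+x. ?E x \<partial>?S) \<le> ennreal (b\<^sup>2)" .
  have c0: "0 \<le> c" by (simp add: c_def)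
  have "(\<integral>\<^sup>+x. ennreal ((?\<tau> x)\<^sup>2) \<partial>?S) \<le> (\<integral>\<^sup>+x. ennreal c * ?E x \<partial>?S)"
    by (rule nn_integral_mono_AE[OF bound])
  also have "\<dots> = ennreal c * (\<integral>\<^sup>+x. ?E x \<partial>?S)"
    by (intro nn_integral_cmult) measurable
  also have "\<dots> \<le> ennreal c * ennreal (b\<^sup>2)"
    by (intro mult_left_mono E) simp
  also have "\<dots> = ennreal (c * b\<^sup>2)" using c0 by (simp add: ennreal_mult)
  finally have fin: "(\<integral>\<^sup>+x. ennreal ((?\<tau> x)\<^sup>2) \<partial>?S) \<le> ennreal (c * b\<^sup>2)" .
  then have int: "integrable ?S (\<lambda>x. (?\<tau> x)\<^sup>2)"
    by (intro integrableI_bounded) (auto simp: ennreal_less_top le_less_trans)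
  have "(\<integral>x. (?\<tau> x)\<^sup>2 \<partial>?S) \<le> c * b\<^sup>2"
    using fin nn_integral_eq_integral[OF int] c0 by simp
  then have "norm_L2 ?S ?\<tau> \<le> sqrt (c * b\<^sup>2)"
    unfolding norm_L2_def by (rule real_sqrt_le_mono)
  also have "\<dots> = sqrt (12 * \<bar>\<rho>m\<bar>) * (Rgas * \<bar>Tm\<bar>) * b"
    using R b0 by (simp add: c_def real_sqrt_mult)
  finally show ?thesis
    unfolding L2_bounded_def in_L2_def using int by simp
qed

section \<open>Absence of first-order stress\<close>

lemma Ck_bounded_continuous: "Ck_bounded D n g \<Longrightarrow> continuous_on UNIV g"
  by (cases n) auto

text \<open>Sobolev embedding for the density and the temperature, which are the components of
  \<open>W t x\<close> along the basis states \<open>(1, 0, 0)\<close> and \<open>(0, 0, 1)\<close>.\<close>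

lemma AE_macroscopic_fields_le:
  fixes W :: "real \<Rightarrow> real^'n \<Rightarrow> 'n::finite state"
  assumes W: "macroscopic_fields \<Omega> s far B N D tstar W" and t: "t \<in> {0..tstar}"
    and A: "(\<integral>\<^sup>+\<xi>. ennreal ((1 + (norm \<xi>)\<^sup>2) powr (- s)) \<partial>(frequency_measure \<Omega> :: (real^'n) measure)) \<le> ennreal A"
    and A0: "0 \<le> A"
  shows "AE x in space_measure \<Omega>. dens (W t x) \<le> \<bar>dens far\<bar> + sqrt A * \<bar>B\<bar>"
    and "AE x in space_measure \<Omega>. temp (W t x) \<le> \<bar>temp far\<bar> + sqrt A * \<bar>B\<bar>"
proof -
  have Hs: "AE x in space_measure \<Omega>. \<bar>(W t x - far) \<bullet> e\<bar> \<le> sqrt A * \<bar>B\<bar>" if "e \<in> Basis" for e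
  proof (rule AE_Hs_bounded_le[OF _ A A0])
    show "Hs_bounded \<Omega> s B (\<lambda>x. (W t x - far) \<bullet> e)"
      using W t that unfolding macroscopic_fields_def by blast
  qed
  have "(1, 0, 0) \<in> (Basis :: 'n state set)" by (simp add: Basis_prod_def zero_prod_def)
  from Hs[OF this] show "AE x in space_measure \<Omega>. dens (W t x) \<le> \<bar>dens far\<bar> + sqrt A * \<bar>B\<bar>"
    by (rule eventually_mono) (auto simp: inner_prod_def)
  have "(0, 0, 1) \<in> (Basis :: 'n state set)" by (simp add: Basis_prod_def zero_prod_def)
  from Hs[OF this] show "AE x in space_measure \<Omega>. temp (W t x) \<le> \<bar>temp far\<bar> + sqrt A * \<bar>B\<bar>"
    by (rule eventually_mono) (auto simp: inner_prod_def)
qed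

lemma macroscopic_fields_borel_measurable:
  assumes "macroscopic_fields \<Omega> s far B N D tstar W" "t \<in> {0..tstar}"
  shows "W t \<in> borel_measurable borel"
  using assms
  by (intro borel_measurable_continuous_onI) (auto simp: macroscopic_fields_def intro: Ck_bounded_continuous)

lemma boltzmann_solution_borel_measurable:
  fixes f :: "real \<Rightarrow> real^'n \<Rightarrow> real^'n::finite \<Rightarrow> real"
  assumes f: "boltzmann_solution \<Omega> kern \<epsilon> tstar f" and t: "t \<in> {0..tstar}"
  shows "case_prod (f t) \<in> borel_measurable borel"
proof -
  have "continuous_on ({0..tstar} \<times> UNIV \<times> UNIV) (\<lambda>(t, x, v). f t x v)"
    using f by (simp add: boltzmann_solution_def)
  moreover have "continuous_on UNIV (\<lambda>z :: (real^'n) \<times> (real^'n). (t, fst z, snd z))"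
    by (intro continuous_intros)
  ultimately have "continuous_on UNIV (\<lambda>z. (\<lambda>(t, x, v). f t x v) (t, fst z, snd z))"
    by (rule continuous_on_compose2) (use t in blast)
  then have "continuous_on UNIV (case_prod (f t))"
    by (simp add: case_prod_beta')
  then show ?thesis
    by (rule borel_measurable_continuous_onI)
qed

text \<open>A vanishing first correction makes the remainder equal to $f_\varepsilon-M$ for every $x$ and
  almost every $v$, so the estimate for perturbed Maxwellians applies to it. The constant is written
  out because it has to be independent of the kernel, the fields and the solution.\<close>

lemma L2_deviatoric_stress_zero_first_correction:
  fixes W :: "real \<Rightarrow> real^'n \<Rightarrow> 'n::finite state"
    and f :: "real \<Rightarrow> real \<Rightarrow> real^'n \<Rightarrow> real^'n \<Rightarrow> real"
  assumes R: "0 < Rgas"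
    and A: "(\<integral>\<^sup>+\<xi>. ennreal ((1 + (norm \<xi>)\<^sup>2) powr (- s)) \<partial>(frequency_measure \<Omega> :: (real^'n) measure)) \<le> ennreal A"
    and A0: "0 \<le> A"
    and W: "macroscopic_fields \<Omega> s far B N D tstar W"
    and sol: "boltzmann_solution \<Omega> kern \<epsilon> tstar (f \<epsilon>)"
    and ce: "ce_expansion \<Omega> Rgas C \<epsilon>0 tstar W f1 f"
    and f1: "\<forall>t\<in>{0..tstar}. \<forall>x. AE v in lborel. f1 t x v = 0"
    and \<epsilon>: "\<epsilon> \<in> {0<..<\<epsilon>0}" and t: "t \<in> {0..tstar}"
  shows "L2_bounded (space_measure \<Omega>)
    (sqrt (12 * \<bar>\<bar>dens far\<bar> + sqrt A * \<bar>B\<bar>\<bar>) * (Rgas * \<bar>\<bar>temp far\<bar> + sqrt A * \<bar>B\<bar>\<bar>) * \<bar>C\<bar> * \<epsilon>\<^sup>2)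
    (\<lambda>x. deviatoric_stress (vel (W t x)) (f \<epsilon> t x) i j)"
  unfolding mult.assoc[of _ "\<bar>C\<bar>"]
proof (rule L2_deviatoric_stress_le[OF R])
  show "positive_state (W t x)" for x
    using W t by (simp add: macroscopic_fields_def)
  show "AE v in lborel. f \<epsilon> t x v = maxwellian Rgas (W t x) v + ce_remainder Rgas W f1 f \<epsilon> t x v" for x
  proof -
    have "AE v in lborel. f1 t x v = 0" using f1 t by blast
    then show ?thesis by (rule eventually_mono) (simp add: ce_remainder_def)
  qed
  have "L2_bounded (L2x_L2v \<Omega> Rgas (W t)) (C * \<epsilon>\<^sup>2) (\<lambda>(x, v). ce_remainder Rgas W f1 f \<epsilon> t x v)"
    using ce \<epsilon> t unfolding ce_expansion_def by blast
  moreover have "C * \<epsilon>\<^sup>2 \<le> \<bar>C\<bar> * \<epsilon>\<^sup>2"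
    by (intro mult_right_mono) simp_all
  ultimately show "L2_bounded (L2x_L2v \<Omega> Rgas (W t)) (\<bar>C\<bar> * \<epsilon>\<^sup>2) (\<lambda>(x, v). ce_remainder Rgas W f1 f \<epsilon> t x v)"
    unfolding L2_bounded_def by linarith
qed (rule macroscopic_fields_borel_measurable[OF W t] boltzmann_solution_borel_measurable[OF sol t]
  AE_macroscopic_fields_le[OF W t A A0])+

theorem corollary6p2:
  fixes \<Omega> :: spatial_domain
    and Rgas s B lambda0 C_inv C :: real
    and far :: "'n::finite state"
  assumes "0 < Rgas" and "real CARD('n) / 2 < s" and "0 < lambda0" and "0 < C_inv"
  shows "\<exists>K\<ge>0. \<forall>(kern :: kernel) (k :: real) (glob :: 'n state) (N :: nat) (D :: real)
           (\<epsilon>0 :: real) (tstar :: real)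
           (W :: real \<Rightarrow> real^'n \<Rightarrow> 'n state)
           (f :: real \<Rightarrow> real \<Rightarrow> real^'n \<Rightarrow> real^'n \<Rightarrow> real)
           (f1 :: real \<Rightarrow> real^'n \<Rightarrow> real^'n \<Rightarrow> real).
         0 < \<epsilon>0 \<longrightarrow> 0 < tstar \<longrightarrow> 1 \<le> N \<longrightarrow>
         collision_law Rgas kern TYPE('n) \<longrightarrow>
         macroscopic_fields \<Omega> s far B N D tstar W \<longrightarrow>
         whole_space_decay \<Omega> Rgas s k glob far \<epsilon>0 tstar W f \<longrightarrow>
         (\<forall>\<epsilon>\<in>{0<..<\<epsilon>0}. initial_datum \<Omega> Rgas s k glob (f \<epsilon> 0)) \<longrightarrow>
         coercivity_assumption \<Omega> kern Rgas lambda0 tstar W \<longrightarrow>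
         inversion_assumption kern Rgas C_inv tstar W \<longrightarrow>
         euler_projection kern Rgas tstar W \<longrightarrow>
         (\<forall>\<epsilon>\<in>{0<..<\<epsilon>0}. boltzmann_solution \<Omega> kern \<epsilon> tstar (f \<epsilon>)) \<longrightarrow>
         first_correction kern Rgas tstar W f1 \<longrightarrow>
         ce_expansion \<Omega> Rgas C \<epsilon>0 tstar W f1 f \<longrightarrow>
         (\<forall>t\<in>{0..tstar}. \<forall>x. AE v in lborel. f1 t x v = 0) \<longrightarrow>
         (\<forall>\<epsilon>\<in>{0<..<\<epsilon>0}. \<forall>t\<in>{0..tstar}. \<forall>i j.
            L2_bounded (space_measure \<Omega>) (K * \<epsilon>\<^sup>2)
              (\<lambda>x. deviatoric_stress (vel (W t x)) (f \<epsilon> t x) i j))"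
proof -
  obtain A where A0: "0 \<le> A"
    and A: "(\<integral>\<^sup>+\<xi>. ennreal ((1 + (norm \<xi>)\<^sup>2) powr (- s)) \<partial>(frequency_measure \<Omega> :: (real^'n) measure)) = ennreal A"
    using nn_integral_bessel_weight[OF assms(2), of \<Omega>]
    by (cases "\<integral>\<^sup>+\<xi>. ennreal ((1 + (norm \<xi>)\<^sup>2) powr (- s)) \<partial>(frequency_measure \<Omega> :: (real^'n) measure)") auto
  define K where "K = sqrt (12 * \<bar>\<bar>dens far\<bar> + sqrt A * \<bar>B\<bar>\<bar>) * (Rgas * \<bar>\<bar>temp far\<bar> + sqrt A * \<bar>B\<bar>\<bar>) * \<bar>C\<bar>"
  have "0 \<le> K"
    unfolding K_def using assms(1) by (intro mult_nonneg_nonneg) simp_all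
  note bound = L2_deviatoric_stress_zero_first_correction[where far = far and B = B and C = C,
      OF assms(1) eq_refl[OF A] A0, folded K_def]
  show ?thesis
  proof (intro exI[of _ K] conjI allI impI ballI)
    show "0 \<le> K" by fact
  qed (rule bound; (assumption | (erule bspec, assumption)))
qed

end
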